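(* Let $a_0$ be a holomorphic function of one complex variable defined near $0\in\mathbb{C}$, and consider the ramified Cauchy problem for the complex inviscid Burgers equation $$u_t-u\,u_x=0,\qquad u(0,x)=a_0(x)+x^{1/3},\qquad (t,x)\in\mathbb{C}^2 .$$ Then there exist three holomorphic functions $a(t,x)$, $p(t,x)$, $q(t,x)$ defined in some neighbourhood of $(0,0)\in\mathbb{C}^2$ such that $$a(0,x)=a_0(x),\qquad p(0,x)=0,\qquad q(0,x)=x,$$ and such that $$u(t,x):=a(t,x)+z(t,x)$$ is the unique solution of this Cauchy problem, where the (ramified) function $z(t,x)$ satisfies the algebraic relation $$z^3=p\,z+q .$$
   Context: Time, space and the unknown $u$ are complex; $u_t,u_x$ are complex partial derivatives. Solving the ramified Cauchy problem means finding an open neighbourhood $U$ of $(0,0)\in\mathbb{C}^2$ and a germ of a holomorphic function $u$ at a point $(0,x_0)\in U$, $x_0\neq 0$, satisfying the equation and the initial condition (for a chosen branch of $x^{1/3}$ near $x_0$), such that $u$ can be continued holomorphically along any path in $U$ that does not meet a certain characteristic hypersurface which restricts to $x=0$ when $t=0$. The branch of $z$ is the one with $z(0,x)=x^{1/3}$ near $x_0$ (the same branch as in the initial condition). Uniqueness refers to the germ of solution at $(0,x_0)$ for the given branch of the datum. *)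

theory Defs
  imports "HOL-Complex_Analysis.Complex_Analysis"
begin

text \<open>
  Points of \<open>\<complex>\<^sup>2\<close> are pairs \<open>(t, x)\<close>. Germs are represented by total functions that are only
  inspected near the base point; equality of germs at \<open>P\<close> is equality eventually in \<open>nhds P\<close>.
\<close>

text \<open>Holomorphy in two variables: the Frechet derivative exists and is complex linear.\<close>

definition holomorphic2_on :: "(complex \<times> complex \<Rightarrow> complex) \<Rightarrow> (complex \<times> complex) set \<Rightarrow> bool" where
  "holomorphic2_on f S \<longleftrightarrow>
     (\<forall>P\<in>S. \<exists>c d. (f has_derivative (\<lambda>(h, k). c * h + d * k)) (at P within S))"

definition holomorphic2_near :: "(complex \<times> complex \<Rightarrow> complex) \<Rightarrow> complex \<times> complex \<Rightarrow> bool" where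
  "holomorphic2_near f P \<longleftrightarrow> (\<exists>W. open W \<and> P \<in> W \<and> holomorphic2_on f W)"

definition deriv_t :: "(complex \<times> complex \<Rightarrow> complex) \<Rightarrow> complex \<times> complex \<Rightarrow> complex" where
  "deriv_t f P = deriv (\<lambda>s. f (s, snd P)) (fst P)"

definition deriv_x :: "(complex \<times> complex \<Rightarrow> complex) \<Rightarrow> complex \<times> complex \<Rightarrow> complex" where
  "deriv_x f P = deriv (\<lambda>y. f (fst P, y)) (snd P)"

definition cube_root_branch :: "(complex \<Rightarrow> complex) \<Rightarrow> complex \<Rightarrow> bool" where
  "cube_root_branch b x0 \<longleftrightarrow> b analytic_on {x0} \<and> (\<forall>\<^sub>F x in nhds x0. b x ^ 3 = x)"

text \<open>
  Analytic continuation of the germ of \<open>u\<close> at \<open>g 0\<close> along the restriction of the path \<open>g\<close> to the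
  parameter interval \<open>I\<close>: \<open>F s\<close> represents the continued germ at \<open>g s\<close>. The interval is
  \<open>{0..1}\<close> for continuation along the whole path, and \<open>{0..<1}\<close> when the end point of \<open>g\<close> may be
  singular.
\<close>

definition continuation_along ::
  "(complex \<times> complex \<Rightarrow> complex) \<Rightarrow> (real \<Rightarrow> complex \<times> complex) \<Rightarrow> real set
     \<Rightarrow> (real \<Rightarrow> complex \<times> complex \<Rightarrow> complex) \<Rightarrow> bool" where
  "continuation_along u g I F \<longleftrightarrow>
     (\<forall>s\<in>I. holomorphic2_near (F s) (g s)) \<and>
     (\<forall>\<^sub>F P in nhds (g 0). F 0 P = u P) \<and>
     (\<forall>s\<in>I. \<forall>\<^sub>F r in at s within I. \<forall>\<^sub>F P in nhds (g r). F r P = F s P)"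

text \<open>\<open>w\<close> is the limit at \<open>P\<close> of a branch of \<open>u\<close>, obtained by continuation from \<open>P0\<close> along a path
  that avoids \<open>K\<close> except possibly at its end point \<open>P\<close>.\<close>

definition branch_limit ::
  "(complex \<times> complex \<Rightarrow> complex) \<Rightarrow> complex \<times> complex \<Rightarrow> (complex \<times> complex) set
     \<Rightarrow> (complex \<times> complex) set \<Rightarrow> complex \<times> complex \<Rightarrow> complex \<Rightarrow> bool" where
  "branch_limit u P0 U K P w \<longleftrightarrow>
     (\<exists>g F. path g \<and> pathstart g = P0 \<and> pathfinish g = P \<and> g ` {0..<1} \<subseteq> U - K \<and>
        continuation_along u g {0..<1} F \<and> ((\<lambda>s. F s (g s)) \<longlongrightarrow> w) (at_left 1))"

text \<open>
  The principal symbol of the equation at a solution \<open>u\<close> is \<open>\<tau> - u \<xi>\<close>, so \<open>S = 0\<close> is characteristic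
  when \<open>S\<^sub>t - u S\<^sub>x = 0\<close> there. As \<open>u\<close> is multivalued around the hypersurface, its value on it is
  the limit of one of its branches. The density of the points where \<open>dS \<noteq> 0\<close> says that \<open>S\<close> is a
  reduced equation; otherwise \<open>S\<^sup>2\<close> would make the condition void.
\<close>

definition characteristic_hypersurface ::
  "(complex \<times> complex \<Rightarrow> complex) \<Rightarrow> complex \<times> complex \<Rightarrow> (complex \<times> complex) set
     \<Rightarrow> (complex \<times> complex) set \<Rightarrow> bool" where
  "characteristic_hypersurface u P0 U K \<longleftrightarrow>
     (\<exists>S. holomorphic2_on S U \<and> K = {P \<in> U. S P = 0} \<and>
        K \<subseteq> closure {P \<in> K. deriv_t S P \<noteq> 0 \<or> deriv_x S P \<noteq> 0} \<and>
        (\<forall>P\<in>K. \<exists>w. branch_limit u P0 U K P w \<and> deriv_t S P - w * deriv_x S P = 0))"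

text \<open>The germ of \<open>u\<close> at \<open>(0, x0)\<close> solves \<open>u\<^sub>t - u u\<^sub>x = 0\<close>, \<open>u (0, x) = a0 x + b x\<close>, where \<open>b\<close> is
  the chosen branch of the cube root.\<close>

definition burgers_cauchy_germ ::
  "(complex \<Rightarrow> complex) \<Rightarrow> (complex \<Rightarrow> complex) \<Rightarrow> complex \<Rightarrow> (complex \<times> complex \<Rightarrow> complex) \<Rightarrow> bool" where
  "burgers_cauchy_germ a0 b x0 u \<longleftrightarrow>
     holomorphic2_near u (0, x0) \<and>
     (\<forall>\<^sub>F P in nhds (0, x0). deriv_t u P - u P * deriv_x u P = 0) \<and>
     (\<forall>\<^sub>F x in nhds x0. u (0, x) = a0 x + b x)"

definition ramified_burgers_solution ::
  "(complex \<Rightarrow> complex) \<Rightarrow> (complex \<Rightarrow> complex) \<Rightarrow> complex \<Rightarrow> (complex \<times> complex) set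
     \<Rightarrow> (complex \<times> complex) set \<Rightarrow> (complex \<times> complex \<Rightarrow> complex) \<Rightarrow> bool" where
  "ramified_burgers_solution a0 b x0 U K u \<longleftrightarrow>
     open U \<and> (0, 0) \<in> U \<and> (0, x0) \<in> U \<and> x0 \<noteq> 0 \<and>
     burgers_cauchy_germ a0 b x0 u \<and>
     characteristic_hypersurface u (0, x0) U K \<and>
     (\<forall>x. (0, x) \<in> U \<longrightarrow> ((0, x) \<in> K \<longleftrightarrow> x = 0)) \<and>
     (\<forall>g. path g \<and> pathstart g = (0, x0) \<and> path_image g \<subseteq> U - K \<longrightarrow>
        (\<exists>F. continuation_along u g {0..1} F))"

end

theory Submission
  imports Defs
begin

text \<open>
  A solution is constant along characteristics, so \<open>u (t, x) = u\<^sub>0 (x + t * u)\<close>. With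
  \<open>w ^ 3 = x + t * u\<close> and \<open>h w = a0 (w ^ 3) + w\<close> this reads \<open>u = h w\<close> on the smooth surface
  \<open>w ^ 3 - t * h w - x = 0\<close>, which is parametrized by \<open>(t, w)\<close> and is a three-sheeted covering of the
  \<open>(t, x)\<close> plane off the set \<open>K\<close> of points with a multiple root. The three values of \<open>u\<close> have
  holomorphic power sums, given by contour integrals of the logarithmic derivative; hence \<open>a\<close> is
  their mean, and \<open>z = u - a\<close> is a root of a cubic without quadratic term. Lifting paths through
  the covering continues \<open>u\<close>. Writing \<open>t = \<sigma>\<^sup>2\<close> uniformizes the double roots, and the curve \<open>K\<close> so
  obtained has tangent direction \<open>(1, - u)\<close>, that is, it is characteristic.
\<close>

subsection \<open>Holomorphic functions of two variables\<close>

text \<open>The coordinate \<open>w\<close> absorbs the ramification: the datum becomes the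
  holomorphic function \<open>h\<close>, with \<open>deriv h 0 = 1\<close>. As \<open>h\<close> is
  known only near 0, the three roots have to be counted in a disc: the bidisc of
  \<open>(t, x)\<close> is so small that \<open>w ^ 3\<close> dominates \<open>t * h w + x\<close>
  on the circle of radius \<open>r\<close>. A single root need not be holomorphic at
  \<open>K\<close>, but no root meets the circle, so the contour integrals are holomorphic across
  \<open>K\<close> as well; they are identified with sums over roots only off \<open>K\<close>. The
  hypersurface is the harder half. Its equation must be reduced, and every point of \<open>K\<close>
  must be the end of a path along which the value of \<open>u\<close> tends to its value at the
  double root. For \<open>a0 = 0\<close> the curve is the cusp \<open>27 * x^2 = 4 * t^3\<close>; in
  general, too, it is singular at the origin, hence the parameter \<open>\<sigma>\<close>. Paths to
  \<open>K\<close> are built upstairs in \<open>(t, w)\<close>, where \<open>h w\<close> stays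
  holomorphic at critical points, and then projected. Uniqueness argues directly with an arbitrary
  solution germ: constancy along characteristics forces its value to be \<open>h w\<close>.\<close>

lemma holomorphic2_onE:
  assumes "holomorphic2_on f S" "open S" "P \<in> S"
  obtains c d where "(f has_derivative (\<lambda>(h, k). c * h + d * k)) (at P)"
  using assms unfolding holomorphic2_on_def by (metis at_within_open)

lemma holomorphic2_onI:
  assumes "\<And>P. P \<in> S \<Longrightarrow> \<exists>c d. (f has_derivative (\<lambda>(h, k). c * h + d * k)) (at P)"
  shows "holomorphic2_on f S"
  using assms unfolding holomorphic2_on_def by (meson has_derivative_at_withinI)

lemma holomorphic2_on_subset:
  "holomorphic2_on f S \<Longrightarrow> T \<subseteq> S \<Longrightarrow> holomorphic2_on f T"
  unfolding holomorphic2_on_def by (meson has_derivative_subset subsetD)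

lemma holomorphic2_on_imp_continuous_on:
  assumes "holomorphic2_on f S" shows "continuous_on S f"
  using assms unfolding holomorphic2_on_def continuous_on_eq_continuous_within
  by (meson has_derivative_continuous)

lemma holomorphic2_on_const: "holomorphic2_on (\<lambda>P. c) S"
  unfolding holomorphic2_on_def
  by (intro ballI exI[of _ 0]) (auto intro!: has_derivative_eq_rhs[OF has_derivative_const])

lemma holomorphic2_on_fst: "holomorphic2_on fst S"
  unfolding holomorphic2_on_def
  by (intro ballI exI[of _ 1] exI[of _ 0])
     (auto intro!: has_derivative_eq_rhs[OF has_derivative_fst[OF has_derivative_ident]])

lemma holomorphic2_on_snd: "holomorphic2_on snd S"
  unfolding holomorphic2_on_def
  by (intro ballI exI[of _ 1] exI[of _ 0])
     (auto intro!: exI[of _ 1] has_derivative_eq_rhs[OF has_derivative_snd[OF has_derivative_ident]])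

lemma holomorphic2_on_add:
  assumes "holomorphic2_on f S" "holomorphic2_on g S"
  shows "holomorphic2_on (\<lambda>P. f P + g P) S"
  unfolding holomorphic2_on_def
proof
  fix P assume "P \<in> S"
  with assms obtain c d c' d' where
    "(f has_derivative (\<lambda>(h, k). c * h + d * k)) (at P within S)"
    "(g has_derivative (\<lambda>(h, k). c' * h + d' * k)) (at P within S)"
    unfolding holomorphic2_on_def by meson
  from has_derivative_add[OF this]
  show "\<exists>c d. ((\<lambda>P. f P + g P) has_derivative (\<lambda>(h, k). c * h + d * k)) (at P within S)"
    by (intro exI[of _ "c + c'"] exI[of _ "d + d'"], elim has_derivative_eq_rhs)
       (auto simp: algebra_simps)
qed

lemma holomorphic2_on_mult:
  assumes "holomorphic2_on f S" "holomorphic2_on g S"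
  shows "holomorphic2_on (\<lambda>P. f P * g P) S"
  unfolding holomorphic2_on_def
proof
  fix P assume "P \<in> S"
  with assms obtain c d c' d' where
    "(f has_derivative (\<lambda>(h, k). c * h + d * k)) (at P within S)"
    "(g has_derivative (\<lambda>(h, k). c' * h + d' * k)) (at P within S)"
    unfolding holomorphic2_on_def by meson
  from has_derivative_mult[OF this]
  show "\<exists>c d. ((\<lambda>P. f P * g P) has_derivative (\<lambda>(h, k). c * h + d * k)) (at P within S)"
    by (intro exI[of _ "f P * c' + c * g P"] exI[of _ "f P * d' + d * g P"], elim has_derivative_eq_rhs)
       (auto simp: algebra_simps)
qed

lemma holomorphic2_on_compose:
  assumes "f holomorphic_on A" "open A" "holomorphic2_on g S" "g ` S \<subseteq> A"
  shows "holomorphic2_on (\<lambda>P. f (g P)) S"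
  unfolding holomorphic2_on_def
proof
  fix P assume "P \<in> S"
  with assms obtain c d where
    g: "(g has_derivative (\<lambda>(h, k). c * h + d * k)) (at P within S)"
    unfolding holomorphic2_on_def by meson
  have "(f has_field_derivative deriv f (g P)) (at (g P))"
    using assms \<open>P \<in> S\<close> holomorphic_derivI by blast
  then have "(f has_derivative (*) (deriv f (g P))) (at (g P))"
    by (simp add: has_field_derivative_def)
  from has_derivative_compose[OF g this]
  show "\<exists>c d. ((\<lambda>P. f (g P)) has_derivative (\<lambda>(h, k). c * h + d * k)) (at P within S)"
    by (intro exI[of _ "deriv f (g P) * c"] exI[of _ "deriv f (g P) * d"], elim has_derivative_eq_rhs)
       (auto simp: algebra_simps)
qed

lemma holomorphic2_on_cmult: "holomorphic2_on f S \<Longrightarrow> holomorphic2_on (\<lambda>P. c * f P) S"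
  by (intro holomorphic2_on_mult holomorphic2_on_const)

lemma holomorphic2_on_diff:
  "holomorphic2_on f S \<Longrightarrow> holomorphic2_on g S \<Longrightarrow> holomorphic2_on (\<lambda>P. f P - g P) S"
  using holomorphic2_on_add[of f S "\<lambda>P. -1 * g P"] holomorphic2_on_cmult[of g S "-1"] by simp

lemma holomorphic2_on_power:
  "holomorphic2_on f S \<Longrightarrow> holomorphic2_on (\<lambda>P. f P ^ n) S"
  by (induction n) (auto intro: holomorphic2_on_mult holomorphic2_on_const)

lemma holomorphic2_on_divide_const:
  "holomorphic2_on f S \<Longrightarrow> holomorphic2_on (\<lambda>P. f P / c) S"
  using holomorphic2_on_cmult[of f S "inverse c"] by (simp add: field_simps)

lemmas holomorphic2_intros = holomorphic2_on_const holomorphic2_on_fst holomorphic2_on_snd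
  holomorphic2_on_add holomorphic2_on_diff holomorphic2_on_mult holomorphic2_on_power
  holomorphic2_on_divide_const

section \<open>Partial derivatives as coefficients of the Frechet derivative\<close>

lemma has_derivative_imp_deriv_t:
  assumes "(f has_derivative (\<lambda>(h, k). c * h + d * k)) (at P)"
  shows "deriv_t f P = c"
proof -
  have "((\<lambda>s. (s, snd P)) has_derivative (\<lambda>h. (h, 0))) (at (fst P))"
    by (auto intro!: derivative_eq_intros)
  from has_derivative_compose[OF this, of f, simplified, OF assms]
  have "((\<lambda>s. f (s, snd P)) has_derivative (*) c) (at (fst P))" by simp
  then show ?thesis unfolding deriv_t_def
    by (simp add: DERIV_imp_deriv has_field_derivative_def)
qed

lemma has_derivative_imp_deriv_x:
  assumes "(f has_derivative (\<lambda>(h, k). c * h + d * k)) (at P)"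
  shows "deriv_x f P = d"
proof -
  have "((\<lambda>s. (fst P, s)) has_derivative (\<lambda>h. (0, h))) (at (snd P))"
    by (auto intro!: derivative_eq_intros)
  from has_derivative_compose[OF this, of f, simplified, OF assms]
  have "((\<lambda>s. f (fst P, s)) has_derivative (*) d) (at (snd P))" by simp
  then show ?thesis unfolding deriv_x_def
    by (simp add: DERIV_imp_deriv has_field_derivative_def)
qed

lemma holomorphic2_on_has_derivative:
  assumes "holomorphic2_on f S" "open S" "P \<in> S"
  shows "(f has_derivative (\<lambda>(h, k). deriv_t f P * h + deriv_x f P * k)) (at P)"
proof -
  obtain c d where f: "(f has_derivative (\<lambda>(h, k). c * h + d * k)) (at P)"
    using holomorphic2_onE[OF assms] .
  show ?thesis
    unfolding has_derivative_imp_deriv_t[OF f] has_derivative_imp_deriv_x[OF f] by (rule f)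
qed

text \<open>Differentiation under the integral sign. The Leibniz rule yields a derivative that is
  the integral of linear maps; since each of them is complex linear, so is the integral.\<close>

lemma holomorphic2_on_contour_integral_circlepath:
  assumes "open U" "convex U"
    and der: "\<And>P w. P \<in> U \<Longrightarrow> cmod w = r \<Longrightarrow>
      ((\<lambda>P. f P w) has_derivative (\<lambda>(h, k). c P w * h + d P w * k)) (at P)"
    and cont: "continuous_on (U \<times> sphere 0 r) (\<lambda>(P, w). c P w)"
      "continuous_on (U \<times> sphere 0 r) (\<lambda>(P, w). d P w)"
      "\<And>P. P \<in> U \<Longrightarrow> continuous_on (sphere 0 r) (f P)"
    and "0 < r"
  shows "holomorphic2_on (\<lambda>P. contour_integral (circlepath 0 r) (f P)) U"
proof (rule holomorphic2_onI)
  fix P0 assume "P0 \<in> U"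
  define e :: "real \<Rightarrow> complex" where "e s = of_real r * exp (2 * of_real pi * \<i> * of_real s)" for s
  define e' :: "real \<Rightarrow> complex" where "e' s = 2 * of_real pi * \<i> * e s" for s
  define F where "F P s = f P (e s) * e' s" for P s
  \<comment> \<open>The Leibniz rule asks for the derivative as a bounded linear function depending
    continuously on the parameters, so \<open>c\<close> and \<open>d\<close>, times the velocity
    \<open>e'\<close>, are packed into one.\<close>
  define F' where "F' P s = (blinfun_mult_right (c P (e s) * e' s) o\<^sub>L fst_blinfun)
      + (blinfun_mult_right (d P (e s) * e' s) o\<^sub>L snd_blinfun)" for P s
  have e_sph: "e s \<in> sphere 0 r" for s
    using \<open>0 < r\<close> by (simp add: e_def norm_mult)
  have cont_e: "continuous_on A e" "continuous_on A e'" for A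
    unfolding e_def e'_def by (intro continuous_intros)+
  have circ: "circlepath 0 r = e"
    by (auto simp: circlepath fun_eq_iff e_def)
  have "vector_derivative e (at s) = e' s" for s
    unfolding circ[symmetric] vector_derivative_circlepath by (simp add: e'_def e_def)
  then have ci: "contour_integral (circlepath 0 r) (f P) = integral (cbox 0 1) (F P)" for P
    unfolding contour_integral_integral F_def cbox_interval circ by simp
  have app: "blinfun_apply (F' P s) = (\<lambda>(h, k). c P (e s) * e' s * h + d P (e s) * e' s * k)" for P s
    by (auto simp: F'_def fun_eq_iff blinfun.add_left)
  have contF': "continuous_on (U \<times> cbox 0 1) (\<lambda>(P, s). F' P s)"
  proof -
    have m: "continuous_on (U \<times> cbox 0 1) (\<lambda>(P, s). (P, e s))"
      unfolding split_beta by (intro continuous_intros continuous_on_compose2[OF cont_e(1)[of UNIV]]) auto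
    have m': "continuous_on (U \<times> cbox 0 1) (\<lambda>x. e' (snd x))"
      by (intro continuous_intros continuous_on_compose2[OF cont_e(2)[of UNIV]]) auto
    have "continuous_on (U \<times> cbox 0 1) (\<lambda>x. c (fst x) (e (snd x)))"
         "continuous_on (U \<times> cbox 0 1) (\<lambda>x. d (fst x) (e (snd x)))"
      using continuous_on_compose2[OF cont(1) m] continuous_on_compose2[OF cont(2) m] e_sph
      by (force simp: split_beta)+
    then show ?thesis unfolding F'_def split_beta
      by (intro continuous_intros bounded_linear.continuous_on[OF bounded_linear_blinfun_mult_right] m')
  qed
  have der': "((\<lambda>P. F P s) has_derivative blinfun_apply (F' P s)) (at P within U)" if "P \<in> U" for P s
  proof -
    have "((\<lambda>P. f P (e s) * e' s) has_derivative (\<lambda>x. (case x of (h, k) \<Rightarrow> c P (e s) * h + d P (e s) * k) * e' s)) (at P)"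
      using der[OF that, of "e s"] e_sph[of s] by (intro has_derivative_mult_left) auto
    then show ?thesis unfolding F_def app
      by (rule has_derivative_at_withinI[OF has_derivative_eq_rhs]) (auto simp: algebra_simps)
  qed
  have intF: "F P integrable_on cbox 0 1" if "P \<in> U" for P
  proof -
    have "continuous_on (cbox 0 1) (\<lambda>s. f P (e s))"
      by (rule continuous_on_compose2[OF cont(3)[OF that] cont_e(1)]) (use e_sph in blast)
    then show ?thesis
      unfolding F_def by (intro integrable_continuous continuous_on_mult cont_e)
  qed
  have main: "((\<lambda>P. integral (cbox 0 1) (F P)) has_derivative integral (cbox 0 1) (F' P0)) (at P0)"
    using leibniz_rule[of U 0 1 F F', OF der' intF contF' \<open>P0 \<in> U\<close> \<open>convex U\<close>]
    unfolding at_within_open[OF \<open>P0 \<in> U\<close> \<open>open U\<close>] .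
  have intF': "F' P0 integrable_on cbox 0 1"
  proof -
    have "continuous_on (cbox 0 1) (\<lambda>s. (P0, s))" by (intro continuous_intros)
    from continuous_on_compose2[OF contF' this] have "continuous_on (cbox 0 1) (\<lambda>s. F' P0 s)"
      using \<open>P0 \<in> U\<close> by (auto simp: image_subset_iff)
    then show ?thesis by (rule integrable_continuous)
  qed
  let ?L = "blinfun_apply (integral (cbox 0 1) (F' P0))"
  \<comment> \<open>Evaluation at a fixed vector is bounded linear and so commutes with the
    integral. The values at \<open>(1, 0)\<close> and \<open>(0, 1)\<close> are then the two complex
    coefficients.\<close>
  have L: "?L v = integral (cbox 0 1) (\<lambda>s. F' P0 s v)" for v
    using integral_linear[OF intF' blinfun.bounded_linear_left[of v]] by (simp add: o_def)
  define A B where "A = ?L (1, 0)" and "B = ?L (0, 1)"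
  have "?L (h, k) = A * h + B * k" for h k
  proof -
    have "?L (h, k) = ?L (h, 0) + ?L (0, k)"
      by (simp flip: blinfun.add_right)
    also have "?L (h, 0) = A * h" unfolding A_def L app by simp
    also have "?L (0, k) = B * k" unfolding B_def L app by simp
    finally show ?thesis .
  qed
  then have "?L = (\<lambda>(h, k). A * h + B * k)" by auto
  with main show "\<exists>c d. ((\<lambda>P. contour_integral (circlepath 0 r) (f P)) has_derivative
      (\<lambda>(h, k). c * h + d * k)) (at P0)"
    unfolding ci by auto
qed

subsection \<open>The roots and their power sums\<close>

text \<open>The numbers \<open>z = u - a\<close> have sum 0, so they are the roots of
  \<open>Z^3 + e2 * Z - e3\<close>; Newton's identities give \<open>p = - e2\<close> as half their
  second power sum and \<open>q = e3\<close> as a third of their third one.\<close>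

lemma power_sums_cubic:
  fixes u1 u2 u3 :: complex
  assumes a: "a = (u1 + u2 + u3) / 3"
    and p: "p = (u1\<^sup>2 + u2\<^sup>2 + u3\<^sup>2 - 3 * a\<^sup>2) / 2"
    and q: "q = (u1 ^ 3 + u2 ^ 3 + u3 ^ 3 - 3 * a * (u1\<^sup>2 + u2\<^sup>2 + u3\<^sup>2) + 6 * a ^ 3) / 3"
    and u: "u \<in> {u1, u2, u3}"
  shows "(u - a) ^ 3 = p * (u - a) + q"
proof -
  define z1 z2 where "z1 = u1 - a" and "z2 = u2 - a"
  have u': "u1 = a + z1" "u2 = a + z2" "u3 = a - z1 - z2"
    using a by (auto simp: z1_def z2_def field_simps)
  have p': "p = z1\<^sup>2 + z1 * z2 + z2\<^sup>2"
    unfolding p u' by (simp add: field_simps power2_eq_square)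
  have q': "q = - z1 * z2 * (z1 + z2)"
    unfolding q u' by (simp add: field_simps power2_eq_square power3_eq_cube)
  have "u - a \<in> {z1, z2, - z1 - z2}" using u unfolding u' by auto
  then show ?thesis unfolding p' q'
    by (auto simp: field_simps power2_eq_square power3_eq_cube)
qed

text \<open>Serves the case \<open>t = 0\<close>, where the roots are the cube roots of
  \<open>x\<close>: the two vanishing sums remove the mixed terms from the power sums of
  \<open>a0 x + w\<close>.\<close>

lemma distinct_cube_roots:
  fixes w1 w2 w3 x :: complex
  assumes "w1 ^ 3 = x" "w2 ^ 3 = x" "w3 ^ 3 = x" "w1 \<noteq> w2" "w1 \<noteq> w3" "w2 \<noteq> w3"
  shows "w1 + w2 + w3 = 0" "w1\<^sup>2 + w2\<^sup>2 + w3\<^sup>2 = 0"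
proof -
  have "(w1 - w2) * (w1\<^sup>2 + w1 * w2 + w2\<^sup>2) = 0" "(w1 - w3) * (w1\<^sup>2 + w1 * w3 + w3\<^sup>2) = 0"
    using assms(1-3) by (auto simp: algebra_simps power2_eq_square power3_eq_cube)
  then have 12: "w1\<^sup>2 + w1 * w2 + w2\<^sup>2 = 0" and 13: "w1\<^sup>2 + w1 * w3 + w3\<^sup>2 = 0"
    using assms(4,5) by auto
  then have "(w2 - w3) * (w1 + w2 + w3) = 0"
    by algebra
  then show s: "w1 + w2 + w3 = 0" using assms(6) by simp
  then show "w1\<^sup>2 + w2\<^sup>2 + w3\<^sup>2 = 0"
    using 12 by algebra
qed

text \<open>With \<open>w\<close> a cube root of \<open>x + t * u\<close>, the solution is \<open>u = h w\<close> on the surface \<open>G (t, x) w = 0\<close>,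
  which is parametrized by \<open>(t, w)\<close> through \<open>\<Phi>\<close>. The smallness condition keeps all three roots in
  \<open>ball 0 r\<close>.\<close>

locale burgers_surface =
  fixes h :: "complex \<Rightarrow> complex" and R r \<delta> \<epsilon> B :: real
  assumes h_holo: "h holomorphic_on ball 0 R"
    and h_bound: "\<And>w. w \<in> ball 0 R \<Longrightarrow> cmod (h w) \<le> B"
    and r_pos: "0 < r" and r_less: "r < R" and \<delta>_pos: "0 < \<delta>" and \<epsilon>_pos: "0 < \<epsilon>"
    and small: "\<delta> * B + \<epsilon> < r ^ 3"
begin

definition G :: "complex \<times> complex \<Rightarrow> complex \<Rightarrow> complex" where
  "G P w = w ^ 3 - fst P * h w - snd P"

definition \<Phi> :: "complex \<times> complex \<Rightarrow> complex \<times> complex" where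
  "\<Phi> Q = (fst Q, snd Q ^ 3 - fst Q * h (snd Q))"

text \<open>Both the \<open>w\<close>-derivative of \<open>G\<close> and the Jacobian determinant of
  \<open>\<Phi>\<close>: its zeros on the surface are at once the multiple roots and the points
  where \<open>(t, x)\<close> fails to be a local coordinate.\<close>

definition jac :: "complex \<times> complex \<Rightarrow> complex" where
  "jac Q = 3 * (snd Q)\<^sup>2 - fst Q * deriv h (snd Q)"

definition U :: "(complex \<times> complex) set" where
  "U = ball 0 \<delta> \<times> ball 0 \<epsilon>"

definition roots :: "complex \<times> complex \<Rightarrow> complex set" where
  "roots P = {w \<in> ball 0 R. G P w = 0}"

definition K :: "(complex \<times> complex) set" where
  "K = {P \<in> U. \<exists>w\<in>roots P. jac (fst P, w) = 0}"

text \<open>The weight \<open>h w ^ k\<close> makes the argument principle sum \<open>u ^ k\<close>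
  over the roots. Writing \<open>jac\<close> for the derivative of \<open>G P\<close> keeps the
  dependence of the integrand on \<open>P\<close> explicit.\<close>

definition psum :: "nat \<Rightarrow> complex \<times> complex \<Rightarrow> complex" where
  "psum k P = contour_integral (circlepath 0 r) (\<lambda>w. jac (fst P, w) * h w ^ k / G P w) / (2 * pi * \<i>)"

definition avg :: "complex \<times> complex \<Rightarrow> complex" where
  "avg P = psum 1 P / 3"

text \<open>Newton's identities for the three numbers \<open>h w - avg P\<close>, whose sum is \<open>0\<close>.\<close>

definition lin_coeff :: "complex \<times> complex \<Rightarrow> complex" where
  "lin_coeff P = (psum 2 P - 3 * (avg P)\<^sup>2) / 2"

definition const_coeff :: "complex \<times> complex \<Rightarrow> complex" where
  "const_coeff P = (psum 3 P - 3 * avg P * psum 2 P + 6 * avg P ^ 3) / 3"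

section \<open>Location and number of the roots\<close>

lemma R_pos: "0 < R" using r_pos r_less by simp

lemma B_nonneg: "0 \<le> B"
  using h_bound[of 0] R_pos norm_ge_zero[of "h 0"] by (auto simp del: norm_ge_zero)

lemma open_U: "open U" and convex_U: "convex U" and zero_in_U: "(0, 0) \<in> U"
  using \<delta>_pos \<epsilon>_pos unfolding U_def by (auto intro: open_Times convex_Times)

lemma h_deriv: "w \<in> ball 0 R \<Longrightarrow> (h has_field_derivative deriv h w) (at w)"
  using h_holo holomorphic_derivI open_ball by blast

text \<open>On the circle of radius \<open>r\<close> this is the hypothesis of Rouche's theorem;
  outside it, it excludes roots.\<close>

lemma G_perturbation:
  assumes "P \<in> U" "w \<in> ball 0 R"
  shows "cmod (fst P * h w + snd P) < r ^ 3"
proof -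
  have "cmod (fst P * h w) \<le> \<delta> * B"
    unfolding norm_mult using assms h_bound[of w] \<delta>_pos
    by (intro mult_mono) (auto simp: U_def mem_Times_iff)
  moreover have "cmod (snd P) < \<epsilon>"
    using assms by (auto simp: U_def mem_Times_iff)
  ultimately show ?thesis
    using norm_triangle_ineq[of "fst P * h w" "snd P"] small by linarith
qed

lemma G_nonzero:
  assumes "P \<in> U" "w \<in> ball 0 R" "r \<le> cmod w"
  shows "G P w \<noteq> 0"
proof
  assume "G P w = 0"
  then have "cmod (w ^ 3) < r ^ 3"
    using G_perturbation[OF assms(1,2)] by (simp add: G_def algebra_simps)
  then show False
    using power_mono[OF assms(3), of 3] r_pos by (simp add: norm_power not_less[symmetric])
qed

lemma roots_less: "P \<in> U \<Longrightarrow> w \<in> roots P \<Longrightarrow> cmod w < r"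
  using G_nonzero[of P w] by (auto simp: roots_def not_less[symmetric])

lemma roots_iff: "P \<in> U \<Longrightarrow> w \<in> roots P \<longleftrightarrow> cmod w < r \<and> G P w = 0"
  using roots_less[of P w] r_less by (auto simp: roots_def)

lemma G_holo: "G P holomorphic_on ball 0 R"
  unfolding G_def[abs_def] by (intro holomorphic_intros h_holo)

lemma deriv_G:
  assumes "w \<in> ball 0 R" shows "deriv (G P) w = jac (fst P, w)"
  unfolding G_def[abs_def] jac_def
  by (rule DERIV_imp_deriv) (auto intro!: derivative_eq_intros h_deriv assms)

lemma finite_roots:
  assumes "P \<in> U" shows "finite (roots P)"
\<comment> \<open>A nonconstant holomorphic function has finitely many zeros in a compact set. In
  the constant case the value at the point \<open>r\<close> is nonzero, so there are no roots at
  all.\<close>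
proof (cases "G P constant_on ball 0 R")
  case True
  then have "roots P = {}"
    using G_nonzero[OF assms, of "of_real r"] r_pos r_less
    by (force simp: constant_on_def roots_def)
  then show ?thesis by simp
next
  case False
  have "roots P \<subseteq> {w \<in> cball 0 r. G P w = 0}"
    using roots_iff[OF assms] by auto
  moreover have "finite {w \<in> cball 0 r. G P w = 0}"
    using r_less by (intro holomorphic_compact_finite_zeros[OF G_holo _ _ _ _ False]) auto
  ultimately show ?thesis by (rule finite_subset)
qed

lemma winding_outside: "z \<notin> ball 0 R \<Longrightarrow> winding_number (circlepath 0 r) z = 0"
  using r_pos r_less
  by (intro winding_number_zero_outside[of _ "cball 0 r"]) auto

lemma winding_inside: "cmod z < r \<Longrightarrow> winding_number (circlepath 0 r) z = 1"
  by (simp add: winding_number_circlepath)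

lemma zorder_simple_root:
  assumes "P \<in> U - K" "w \<in> roots P" shows "zorder (G P) w = 1"
proof (rule zorder_zero_eqI)
  show "G P holomorphic_on ball 0 R" by (rule G_holo)
  show "w \<in> ball 0 R" using assms by (simp add: roots_def)
  then show "(deriv ^^ nat 1) (G P) w \<noteq> 0"
    using assms by (auto simp: deriv_G K_def)
  show "(deriv ^^ i) (G P) w = 0" if "i < nat 1" for i
    using that assms by (auto simp: roots_def)
qed auto

text \<open>Rouche's theorem compares \<open>G P\<close> with \<open>w ^ 3\<close>, whose only zero
  has order 3. Off \<open>K\<close> every root is simple, so the count with multiplicity is the
  cardinality.\<close>

lemma card_roots:
  assumes "P \<in> U - K" shows "card (roots P) = 3"
proof -
  define g where "g w = - fst P * h w - snd P" for w
  have fg: "(\<lambda>w. w ^ 3 + g w) = G P" by (auto simp: fun_eq_iff G_def g_def)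
  have z0: "{w \<in> ball 0 R. w ^ 3 = 0} = {0::complex}" using R_pos by auto
  have "(\<Sum>p\<in>{w \<in> ball 0 R. w ^ 3 + g w = 0}. winding_number (circlepath 0 r) p * zorder (\<lambda>w. w ^ 3 + g w) p)
      = (\<Sum>p\<in>{w \<in> ball 0 R. w ^ 3 = 0}. winding_number (circlepath 0 r) p * zorder (\<lambda>w. w ^ 3) p)"
  proof (rule Rouche_theorem)
    show "finite {w \<in> ball 0 R. w ^ 3 + g w = 0}"
      using finite_roots[of P] assms fun_cong[OF fg] by (auto simp: roots_def)
    show "finite {w \<in> ball 0 R. w ^ 3 = (0::complex)}" unfolding z0 by simp
    show "g holomorphic_on ball 0 R"
      unfolding g_def[abs_def] by (intro holomorphic_intros h_holo)
    show "\<forall>z\<in>path_image (circlepath 0 r). cmod (g z) < cmod (z ^ 3)"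
    proof
      fix z assume "z \<in> path_image (circlepath 0 r)"
      then have "cmod z = r" using r_pos by simp
      moreover have "g z = - (fst P * h z + snd P)" by (simp add: g_def)
      ultimately show "cmod (g z) < cmod (z ^ 3)"
        using G_perturbation[of P z] assms r_less by (simp add: norm_power del: minus_add_distrib)
    qed
  qed (use r_pos r_less winding_outside in \<open>auto intro!: holomorphic_intros\<close>)
  also have "\<dots> = 3"
  proof -
    have "zorder (\<lambda>w::complex. w ^ 3) 0 = 3"
      by (rule zorder_eqI[of UNIV _ "\<lambda>_. 1"]) (auto simp: power_int_def)
    then show ?thesis unfolding z0 using r_pos by (simp add: winding_inside)
  qed
  also have "(\<Sum>p\<in>{w \<in> ball 0 R. w ^ 3 + g w = 0}. winding_number (circlepath 0 r) p * zorder (\<lambda>w. w ^ 3 + g w) p)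
      = (\<Sum>p\<in>roots P. 1)"
    unfolding fg fun_cong[OF fg]
    using assms roots_less[of P] by (intro sum.cong) (auto simp: zorder_simple_root winding_inside roots_def)
  finally have "of_nat (card (roots P)) = (of_nat 3 :: complex)" by simp
  then show ?thesis by (simp only: of_nat_eq_iff)
qed

section \<open>Power sums of the roots\<close>

lemma psum_eq:
  assumes "P \<in> U - K" shows "psum k P = (\<Sum>w\<in>roots P. h w ^ k)"
proof -
  \<comment> \<open>The empty set stands in the place that the argument principle reserves for
    poles.\<close>
  have eq: "{w \<in> ball 0 R. G P w = 0 \<or> w \<in> {}} = roots P" by (auto simp: roots_def)
  have "contour_integral (circlepath 0 r) (\<lambda>w. deriv (G P) w * h w ^ k / G P w) =
     2 * pi * \<i> * (\<Sum>p\<in>{w \<in> ball 0 R. G P w = 0 \<or> w \<in> {}}.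
        winding_number (circlepath 0 r) p * h p ^ k * zorder (G P) p)"
  proof (rule argument_principle)
    show "path_image (circlepath 0 r) \<subseteq> ball 0 R - {w \<in> ball 0 R. G P w = 0 \<or> w \<in> {}}"
      using G_nonzero[of P] assms r_pos r_less by auto
    show "finite {w \<in> ball 0 R. G P w = 0 \<or> w \<in> {}}"
      unfolding eq using finite_roots assms by auto
  qed (use winding_outside in \<open>auto intro!: holomorphic_intros G_holo h_holo\<close>)
  also have "contour_integral (circlepath 0 r) (\<lambda>w. deriv (G P) w * h w ^ k / G P w) =
      contour_integral (circlepath 0 r) (\<lambda>w. jac (fst P, w) * h w ^ k / G P w)"
    using r_pos r_less by (intro contour_integral_cong) (auto simp: deriv_G)
  also have "(\<Sum>p\<in>{w \<in> ball 0 R. G P w = 0 \<or> w \<in> {}}.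
        winding_number (circlepath 0 r) p * h p ^ k * zorder (G P) p) = (\<Sum>w\<in>roots P. h w ^ k)"
    unfolding eq using assms roots_less[of P]
    by (intro sum.cong) (auto simp: zorder_simple_root winding_inside)
  finally show ?thesis by (simp add: psum_def)
qed

lemma cubic_relation:
  assumes "P \<in> U - K" "w \<in> roots P"
  shows "(h w - avg P) ^ 3 = lin_coeff P * (h w - avg P) + const_coeff P"
proof -
  obtain w1 w2 w3 where w: "roots P = {w1, w2, w3}" "w1 \<noteq> w2" "w1 \<noteq> w3" "w2 \<noteq> w3"
    using card_roots[OF assms(1)] by (auto simp: card_3_iff)
  show ?thesis
    by (rule power_sums_cubic[of _ "h w1" "h w2" "h w3"])
       (use assms w in \<open>auto simp: avg_def lin_coeff_def const_coeff_def psum_eq algebra_simps\<close>)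
qed

text \<open>\<open>G\<close> has no zero on the contour for any \<open>P\<close> in
  \<open>U\<close>, so the integrand depends holomorphically on \<open>P\<close> even over
  \<open>K\<close>. The functions \<open>c\<close> and \<open>d\<close> are the quotient rule for
  the \<open>t\<close>- and \<open>x\<close>-derivatives, with \<open>G\<close> having derivatives
  \<open>- h w\<close> and \<open>- 1\<close>.\<close>

lemma psum_holo: "holomorphic2_on (psum k) U"
proof -
  have hd: "deriv h holomorphic_on ball 0 R" by (intro holomorphic_deriv h_holo open_ball)
  have sph: "sphere 0 r \<subseteq> ball 0 R" using r_less by auto
  have hc: "continuous_on (sphere 0 r) h" "continuous_on (sphere 0 r) (deriv h)"
    using sph h_holo hd continuous_on_subset holomorphic_on_imp_continuous_on by blast+
  have jc: "continuous_on (U \<times> sphere 0 r) (\<lambda>x. h (snd x))"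
    "continuous_on (U \<times> sphere 0 r) (\<lambda>x. deriv h (snd x))"
    by (auto intro!: continuous_on_compose2[OF hc(1)] continuous_on_compose2[OF hc(2)] continuous_intros)
  have nz: "G P w \<noteq> 0" if "P \<in> U" "cmod w = r" for P w
    using G_nonzero[of P w] that r_less by auto
  have "holomorphic2_on (\<lambda>P. contour_integral (circlepath 0 r) (\<lambda>w. jac (fst P, w) * h w ^ k / G P w)) U"
  proof (rule holomorphic2_on_contour_integral_circlepath[where
        c = "\<lambda>P w. (- deriv h w * h w ^ k * G P w + jac (fst P, w) * h w ^ k * h w) / (G P w * G P w)" and
        d = "\<lambda>P w. jac (fst P, w) * h w ^ k / (G P w * G P w)"])
    fix P w assume "P \<in> U" "cmod w = r"
    then have "G P w \<noteq> 0" by (rule nz)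
    then show "((\<lambda>P. jac (fst P, w) * h w ^ k / G P w) has_derivative
       (\<lambda>(ha, ka). (- deriv h w * h w ^ k * G P w + jac (fst P, w) * h w ^ k * h w) / (G P w * G P w) * ha
          + jac (fst P, w) * h w ^ k / (G P w * G P w) * ka)) (at P)"
      unfolding jac_def G_def
      by (auto intro!: derivative_eq_intros simp: fun_eq_iff divide_simps) (auto simp: algebra_simps)
  next
    show "continuous_on (U \<times> sphere 0 r) (\<lambda>(P, w). (- deriv h w * h w ^ k * G P w + jac (fst P, w) * h w ^ k * h w) / (G P w * G P w))"
      unfolding split_beta
      by (intro continuous_intros; use nz in \<open>auto simp: G_def jac_def intro!: continuous_intros jc\<close>)
    show "continuous_on (U \<times> sphere 0 r) (\<lambda>(P, w). jac (fst P, w) * h w ^ k / (G P w * G P w))"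
      unfolding split_beta
      by (intro continuous_intros; use nz in \<open>auto simp: G_def jac_def intro!: continuous_intros jc\<close>)
    fix P assume "P \<in> U"
    then show "continuous_on (sphere 0 r) (\<lambda>w. jac (fst P, w) * h w ^ k / G P w)"
      by (intro continuous_intros; use nz in \<open>auto simp: G_def jac_def intro!: continuous_intros hc\<close>)
  qed (use open_U convex_U r_pos in auto)
  then show ?thesis unfolding psum_def[abs_def] by (rule holomorphic2_on_divide_const)
qed

lemma avg_holo: "holomorphic2_on avg U"
  unfolding avg_def[abs_def] by (intro holomorphic2_on_divide_const psum_holo)

lemma lin_coeff_holo: "holomorphic2_on lin_coeff U"
  unfolding lin_coeff_def[abs_def] by (intro holomorphic2_intros psum_holo avg_holo)

lemma const_coeff_holo: "holomorphic2_on const_coeff U"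
  unfolding const_coeff_def[abs_def] by (intro holomorphic2_intros psum_holo avg_holo)

end

subsection \<open>Analytic continuation along lifted paths\<close>

lemma finite_separated:
  fixes S :: "'a::metric_space set"
  assumes "finite S"
  obtains e where "0 < e" "\<And>x y. x \<in> S \<Longrightarrow> y \<in> S \<Longrightarrow> x \<noteq> y \<Longrightarrow> ball x e \<inter> ball y e = {}"
proof -
  have "\<exists>e>0. \<forall>x\<in>S. \<forall>y\<in>S. x \<noteq> y \<longrightarrow> 2 * e \<le> dist x y"
  proof -
    define D where "D = insert 1 {dist x y |x y. x \<in> S \<and> y \<in> S \<and> x \<noteq> y}"
    have "D \<subseteq> insert 1 ((\<lambda>(x, y). dist x y) ` (S \<times> S))" unfolding D_def by auto
    then have "finite D" using assms finite_subset by blast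
    moreover have "\<forall>d\<in>D. 0 < d" "D \<noteq> {}" by (auto simp: D_def)
    ultimately have "0 < Min D" "\<forall>d\<in>D. Min D \<le> d" by auto
    then show ?thesis by (intro exI[of _ "Min D / 2"]) (auto simp: D_def)
  qed
  then obtain e where e: "e > 0" "\<forall>x\<in>S. \<forall>y\<in>S. x \<noteq> y \<longrightarrow> 2 * e \<le> dist x y" by blast
  show thesis
  proof (rule that[OF e(1)])
    fix x y assume "x \<in> S" "y \<in> S" "x \<noteq> y"
    then have "2 * e \<le> dist x y" using e(2) by blast
    then show "ball x e \<inter> ball y e = {}"
      by (auto simp: disjoint_iff) (smt (verit) dist_commute dist_triangle)
  qed
qed

context burgers_surface
begin

text \<open>A piece of the surface on which \<open>(t, x)\<close> is a coordinate. The derivative of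
  \<open>w\<close> is that of implicit differentiation in \<open>G = 0\<close>; it is recorded
  because holomorphy of \<open>h w\<close> and Burgers' equation can both be read off from
  it.\<close>

definition local_sheet ::
  "(complex \<times> complex) set \<Rightarrow> (complex \<times> complex) set \<Rightarrow> (complex \<times> complex \<Rightarrow> complex \<times> complex) \<Rightarrow> bool" where
  "local_sheet N V g \<longleftrightarrow> open N \<and> open V \<and> N \<subseteq> UNIV \<times> ball 0 R \<and> homeomorphism N V \<Phi> g \<and>
     (\<forall>P\<in>V. jac (g P) \<noteq> 0 \<and>
        ((\<lambda>P. snd (g P)) has_derivative (\<lambda>(a, b). h (snd (g P)) / jac (g P) * a + 1 / jac (g P) * b)) (at P))"

lemma G_iff: "G P w = 0 \<longleftrightarrow> \<Phi> (fst P, w) = P"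
  by (cases P) (auto simp: G_def \<Phi>_def)

lemma fst_\<Phi> [simp]: "fst (\<Phi> Q) = fst Q"
  by (simp add: \<Phi>_def)

lemma continuous_on_\<Phi>: "continuous_on (UNIV \<times> ball 0 R) \<Phi>"
  unfolding \<Phi>_def[abs_def]
  by (intro continuous_intros continuous_on_compose2[OF holomorphic_on_imp_continuous_on[OF h_holo]]) auto

lemma local_sheetD:
  assumes "local_sheet N V g"
  shows "open N" "open V" "N \<subseteq> UNIV \<times> ball 0 R" "homeomorphism N V \<Phi> g"
    "\<And>P. P \<in> V \<Longrightarrow> \<Phi> (g P) = P" "\<And>P. P \<in> V \<Longrightarrow> g P \<in> N" "\<And>P. P \<in> V \<Longrightarrow> fst (g P) = fst P"
    "\<And>Q. Q \<in> N \<Longrightarrow> g (\<Phi> Q) = Q" "\<And>Q. Q \<in> N \<Longrightarrow> \<Phi> Q \<in> V" "continuous_on V g"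
    "\<And>P. P \<in> V \<Longrightarrow> snd (g P) \<in> ball 0 R"
proof -
  show 1: "open N" "open V" "N \<subseteq> UNIV \<times> ball 0 R" "homeomorphism N V \<Phi> g"
    using assms by (auto simp: local_sheet_def)
  show 2: "\<Phi> (g P) = P" "g P \<in> N" if "P \<in> V" for P
    using 1(4) that by (auto simp: homeomorphism_def)
  show "fst (g P) = fst P" if "P \<in> V" for P
    using 2(1)[OF that] fst_\<Phi>[of "g P"] by simp
  show "snd (g P) \<in> ball 0 R" if "P \<in> V" for P
    using 2(2)[OF that] 1(3) by (force simp del: mem_ball)
  show "g (\<Phi> Q) = Q" "\<Phi> Q \<in> V" if "Q \<in> N" for Q
    using 1(4) that by (auto simp: homeomorphism_def)
  show "continuous_on V g" using 1(4) by (auto simp: homeomorphism_def)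
qed

text \<open>The inverse function theorem for \<open>\<Phi>\<close>: its Jacobian matrix is
  triangular with diagonal entries 1 and \<open>jac\<close>.\<close>

lemma local_sheet_exists:
  assumes Q: "snd Q \<in> ball 0 R" "jac Q \<noteq> 0"
  shows "\<exists>N V g. local_sheet N V g \<and> Q \<in> N"
proof -
  let ?D = "UNIV \<times> ball 0 R :: (complex \<times> complex) set"
  define E where "E = Blinfun (\<lambda>x::complex. (0::complex, x))"
  have E: "blinfun_apply E = (\<lambda>x. (0, x))"
    unfolding E_def by (intro bounded_linear_Blinfun_apply bounded_linear_intros)
  define E1 where "E1 = Blinfun (\<lambda>x::complex. (x, 0::complex))"
  have E1: "blinfun_apply E1 = (\<lambda>x. (x, 0))"
    unfolding E1_def by (intro bounded_linear_Blinfun_apply bounded_linear_intros)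
  define f' where "f' Q = (E1 o\<^sub>L fst_blinfun) + (E o\<^sub>L (blinfun_mult_right (- h (snd Q)) o\<^sub>L fst_blinfun))
     + (E o\<^sub>L (blinfun_mult_right (jac Q) o\<^sub>L snd_blinfun))" for Q
  have f': "blinfun_apply (f' Q) = (\<lambda>(a, b). (a, - h (snd Q) * a + jac Q * b))" for Q
    by (auto simp: f'_def fun_eq_iff blinfun.add_left E E1)
  \<comment> \<open>The inverse of the triangular matrix with rows \<open>(1, 0)\<close> and
    \<open>(- h, jac)\<close>.\<close>
  define invf where "invf = (E1 o\<^sub>L fst_blinfun)
     + (E o\<^sub>L (blinfun_mult_right (h (snd Q) / jac Q) o\<^sub>L fst_blinfun))
     + (E o\<^sub>L (blinfun_mult_right (1 / jac Q) o\<^sub>L snd_blinfun))"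
  have "invf o\<^sub>L f' Q = id_blinfun"
    by (rule blinfun_eqI) (use Q in \<open>auto simp: invf_def f' blinfun.add_left E E1 field_simps\<close>)
  moreover have "(\<Phi> has_derivative blinfun_apply (f' X)) (at X)" if "X \<in> ?D" for X
  proof -
    have "(h has_derivative (*) (deriv h (snd X))) (at (snd X))"
      using h_deriv[of "snd X"] that by (auto simp: has_field_derivative_def mem_Times_iff)
    from has_derivative_compose[OF has_derivative_snd[OF has_derivative_ident] this]
    have "((\<lambda>X. h (snd X)) has_derivative (\<lambda>v. deriv h (snd X) * snd v)) (at X)" .
    then show ?thesis
      unfolding f' \<Phi>_def[abs_def] jac_def
      by (auto intro!: derivative_eq_intros simp: fun_eq_iff algebra_simps power2_eq_square)
  qed
  moreover have "continuous_on ?D f'"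
  proof -
    have "deriv h holomorphic_on ball 0 R" by (intro holomorphic_deriv h_holo open_ball)
    then have hd: "continuous_on (ball 0 R) h" "continuous_on (ball 0 R) (deriv h)"
      using h_holo holomorphic_on_imp_continuous_on by blast+
    have sn: "continuous_on ?D snd" "snd ` ?D \<subseteq> ball 0 R"
      by (auto intro: continuous_intros)
    have c: "continuous_on ?D (\<lambda>X. h (snd X))" "continuous_on ?D (\<lambda>X. deriv h (snd X))"
      using continuous_on_compose2[OF hd(1) sn] continuous_on_compose2[OF hd(2) sn] by blast+
    then have "continuous_on ?D jac"
      unfolding jac_def[abs_def] by (intro continuous_intros)
    with c show ?thesis
      unfolding f'_def[abs_def]
      by (intro continuous_intros bounded_linear.continuous_on[OF bounded_linear_blinfun_mult_right])
  qed
  moreover have "open ?D" by (intro open_Times) auto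
  moreover have "Q \<in> ?D" using Q by (auto simp: mem_Times_iff)
  ultimately obtain N V g g' where ift: "open N" "N \<subseteq> ?D" "Q \<in> N" "open V" "homeomorphism N V \<Phi> g"
    and g': "\<And>y. y \<in> V \<Longrightarrow> (g has_derivative (g' y)) (at y)"
    "\<And>y. y \<in> V \<Longrightarrow> g' y = inv (blinfun_apply (f' (g y)))"
    "\<And>y. y \<in> V \<Longrightarrow> bij (blinfun_apply (f' (g y)))"
    using inverse_function_theorem[of ?D \<Phi> f' Q invf] by metis
  have "jac (g P) \<noteq> 0 \<and>
     ((\<lambda>P. snd (g P)) has_derivative (\<lambda>(a, b). h (snd (g P)) / jac (g P) * a + 1 / jac (g P) * b)) (at P)"
    if "P \<in> V" for P
  proof -
    have bij: "bij (blinfun_apply (f' (g P)))" by (rule g'(3)[OF that])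
    \<comment> \<open>The theorem makes the differential bijective at all points of the sheet; where
      \<open>jac\<close> vanishes it would kill \<open>(0, 1)\<close>.\<close>
    have nz: "jac (g P) \<noteq> 0"
    proof
      assume "jac (g P) = 0"
      then have "blinfun_apply (f' (g P)) (0, 1) = blinfun_apply (f' (g P)) (0, 0)"
        unfolding f' by simp
      then have "(0::complex, 1::complex) = (0, 0)" using bij_is_inj[OF bij] by (simp only: inj_eq)
      then show False by simp
    qed
    have "snd (g' P (a, b)) = h (snd (g P)) / jac (g P) * a + 1 / jac (g P) * b" for a b
    proof -
      have "blinfun_apply (f' (g P)) (g' P (a, b)) = (a, b)"
        unfolding g'(2)[OF that] using bij by (simp add: bij_is_surj surj_f_inv_f)
      then show ?thesis using nz unfolding f' by (auto simp: split_beta field_simps)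
    qed
    then have eq: "(\<lambda>v. snd (g' P v)) = (\<lambda>(a, b). h (snd (g P)) / jac (g P) * a + 1 / jac (g P) * b)"
      by (auto simp: fun_eq_iff)
    show ?thesis
      using nz has_derivative_snd[OF g'(1)[OF that]] unfolding eq by blast
  qed
  with ift show ?thesis unfolding local_sheet_def by blast
qed

text \<open>Continuity keeps \<open>g P\<close> in \<open>N'\<close> for \<open>P\<close> near
  \<open>\<Phi> Q\<close>, and there \<open>g'\<close> undoes \<open>\<Phi>\<close>, so that
  \<open>g' P = g' (\<Phi> (g P)) = g P\<close>.\<close>

lemma sheets_agree:
  assumes "local_sheet N V g" "local_sheet N' V' g'" "Q \<in> N" "Q \<in> N'"
  shows "\<forall>\<^sub>F P in nhds (\<Phi> Q). g P = g' P"
proof -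
  note 1 = local_sheetD[OF assms(1)] and 2 = local_sheetD[OF assms(2)]
  have V: "\<forall>\<^sub>F P in nhds (\<Phi> Q). P \<in> V"
    using 1 assms by (intro eventually_nhds_in_open) auto
  have "isCont g (\<Phi> Q)"
    using continuous_on_eq_continuous_at[OF 1(2)] 1(10) 1(9)[OF assms(3)] by blast
  then have "(g \<longlongrightarrow> Q) (nhds (\<Phi> Q))"
    unfolding isCont_def using 1(8)[OF assms(3)] tendsto_at_iff_tendsto_nhds by metis
  then have "\<forall>\<^sub>F P in nhds (\<Phi> Q). g P \<in> N'"
    using 2(1) assms(4) by (rule topological_tendstoD)
  with V show ?thesis
    by eventually_elim (metis 1(5) 2(8))
qed

lemma sheet_has_derivative:
  assumes "local_sheet N V g" "P \<in> V"
  shows "((\<lambda>P. h (snd (g P))) has_derivative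
    (\<lambda>(a, b). deriv h (snd (g P)) * h (snd (g P)) / jac (g P) * a + deriv h (snd (g P)) / jac (g P) * b)) (at P)"
proof -
  have 1: "(h has_derivative (*) (deriv h (snd (g P)))) (at (snd (g P)))"
    using h_deriv[of "snd (g P)"] local_sheetD(11)[OF assms] by (simp add: has_field_derivative_def)
  have "((\<lambda>P. snd (g P)) has_derivative (\<lambda>(a, b). h (snd (g P)) / jac (g P) * a + 1 / jac (g P) * b)) (at P)"
    using assms by (auto simp: local_sheet_def)
  from has_derivative_compose[OF this 1] show ?thesis
    by (rule has_derivative_eq_rhs) (auto simp: fun_eq_iff algebra_simps)
qed

lemma sheet_holomorphic:
  assumes "local_sheet N V g" shows "holomorphic2_on (\<lambda>P. h (snd (g P))) V"
  using sheet_has_derivative[OF assms] by (intro holomorphic2_onI) blast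

text \<open>The two derivatives of \<open>u = h w\<close> are \<open>h' * h / jac\<close> and
  \<open>h' / jac\<close>; their ratio is \<open>u\<close> itself.\<close>

lemma sheet_burgers:
  assumes "local_sheet N V g" "P \<in> V"
  shows "deriv_t (\<lambda>P. h (snd (g P))) P - h (snd (g P)) * deriv_x (\<lambda>P. h (snd (g P))) P = 0"
  unfolding has_derivative_imp_deriv_t[OF sheet_has_derivative[OF assms]]
    has_derivative_imp_deriv_x[OF sheet_has_derivative[OF assms]]
  by simp

text \<open>Each point of the lift lies on some sheet, and the sheets of nearby parameters share a
  point of the lift, hence agree near its image. The parameter set is left open so that the
  half-open interval of \<open>branch_limit\<close> is covered; the values of \<open>F\<close> are
  exported to compute that limit.\<close>

lemma continuation_along_lift:
  assumes \<gamma>: "continuous_on I \<gamma>" "0 \<in> I" "\<And>s. s \<in> I \<Longrightarrow> snd (\<gamma> s) \<in> ball 0 R \<and> jac (\<gamma> s) \<noteq> 0"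
    and sheet: "local_sheet N V g" "\<gamma> 0 \<in> N"
    and path: "\<And>s. s \<in> I \<Longrightarrow> \<Phi> (\<gamma> s) = c s"
  obtains F where "continuation_along (\<lambda>P. h (snd (g P))) c I F"
    "\<And>s. s \<in> I \<Longrightarrow> F s (c s) = h (snd (\<gamma> s))"
proof -
  have "\<forall>s\<in>I. \<exists>N V g. local_sheet N V g \<and> \<gamma> s \<in> N"
    using local_sheet_exists \<gamma>(3) by blast
  then obtain N' V' g' where sh: "\<And>s. s \<in> I \<Longrightarrow> local_sheet (N' s) (V' s) (g' s) \<and> \<gamma> s \<in> N' s"
    by metis
  define F where "F s P = h (snd (g' s P))" for s P
  have "continuation_along (\<lambda>P. h (snd (g P))) c I F"
    unfolding continuation_along_def
  proof (intro conjI ballI)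
    fix s assume s: "s \<in> I"
    then have "holomorphic2_on (F s) (V' s)" "open (V' s)" "c s \<in> V' s"
      using sh[OF s] sheet_holomorphic local_sheetD(2) local_sheetD(9)[of "N' s" "V' s" "g' s" "\<gamma> s"] path[OF s]
      by (auto simp: F_def[abs_def])
    then show "holomorphic2_near (F s) (c s)"
      unfolding holomorphic2_near_def by blast
    have "\<forall>\<^sub>F r in at s within I. \<gamma> r \<in> N' s"
      using \<gamma>(1) s sh[OF s] local_sheetD(1)
      by (intro topological_tendstoD[of \<gamma> "\<gamma> s"]) (auto simp: continuous_on_def)
    moreover have "\<forall>\<^sub>F r in at s within I. r \<in> I"
      by (simp add: eventually_at_filter)
    ultimately show "\<forall>\<^sub>F r in at s within I. \<forall>\<^sub>F P in nhds (c r). F r P = F s P"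
    proof eventually_elim
      case (elim r)
      then have "\<forall>\<^sub>F P in nhds (\<Phi> (\<gamma> r)). g' r P = g' s P"
        using sh[OF s] sh[of r] sheets_agree by blast
      then show ?case
        unfolding path[OF elim(2)] F_def by (auto elim: eventually_mono)
    qed
  next
    have "\<forall>\<^sub>F P in nhds (\<Phi> (\<gamma> 0)). g' 0 P = g P"
      using sh[OF \<gamma>(2)] sheet sheets_agree by blast
    then show "\<forall>\<^sub>F P in nhds (c 0). F 0 P = h (snd (g P))"
      unfolding path[OF \<gamma>(2)] F_def by (auto elim: eventually_mono)
  qed
  moreover have "F s (c s) = h (snd (\<gamma> s))" if "s \<in> I" for s
    using sh[OF that] local_sheetD(8) path[OF that] unfolding F_def by metis
  ultimately show thesis by (rule that)
qed

section \<open>The covering over the complement of the critical set\<close>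

definition regular_points :: "(complex \<times> complex) set" where
  "regular_points = {Q. cmod (snd Q) < r \<and> \<Phi> Q \<in> U - K}"

lemma regular_points_iff:
  "Q \<in> regular_points \<longleftrightarrow> \<Phi> Q \<in> U - K \<and> snd Q \<in> roots (\<Phi> Q)"
  using roots_iff[of "\<Phi> Q"] G_iff[of "\<Phi> Q" "snd Q"] by (auto simp: regular_points_def)

lemma jac_nonzero: "Q \<in> regular_points \<Longrightarrow> jac Q \<noteq> 0"
  unfolding regular_points_iff by (auto simp: K_def)

lemma regular_points_ball: "Q \<in> regular_points \<Longrightarrow> snd Q \<in> ball 0 R"
  using r_less by (auto simp: regular_points_def)

text \<open>Around each root over \<open>P\<close> there is a sheet; over a small \<open>T\<close>
  these stay in disjoint discs of the \<open>w\<close>-plane. That they exhaust the fibre follows by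
  counting, because every fibre has exactly three points.\<close>

lemma covering_regular: "covering_space regular_points \<Phi> (U - K)"
proof
  show "continuous_on regular_points \<Phi>"
    using regular_points_ball by (intro continuous_on_subset[OF continuous_on_\<Phi>]) (force simp: mem_Times_iff simp del: mem_ball)
  show "\<Phi> ` regular_points = U - K"
  proof
    show "U - K \<subseteq> \<Phi> ` regular_points"
    proof
      fix P assume P: "P \<in> U - K"
      then obtain w where "w \<in> roots P" using card_roots[OF P] by (metis card.empty ex_in_conv zero_neq_numeral)
      then have "\<Phi> (fst P, w) = P" by (simp add: roots_def flip: G_iff)
      then show "P \<in> \<Phi> ` regular_points"
        using P \<open>w \<in> roots P\<close> by (intro image_eqI[of _ _ "(fst P, w)"]) (auto simp: regular_points_iff)
    qed
  qed (auto simp: regular_points_iff)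
next
  fix P assume P: "P \<in> U - K"
  have "\<forall>w\<in>roots P. \<exists>N V g. local_sheet N V g \<and> (fst P, w) \<in> N"
    using P by (intro ballI local_sheet_exists) (auto simp: roots_def K_def)
  then obtain N V g where sh: "\<And>w. w \<in> roots P \<Longrightarrow> local_sheet (N w) (V w) (g w) \<and> (fst P, w) \<in> N w"
    by metis
  note shD = local_sheetD[OF conjunct1[OF sh]]
  have fin: "finite (roots P)" using P finite_roots by blast
  obtain e where e: "0 < e" "\<And>x y. x \<in> roots P \<Longrightarrow> y \<in> roots P \<Longrightarrow> x \<noteq> y \<Longrightarrow> ball x e \<inter> ball y e = {}"
    using finite_separated[OF fin] by metis
  have \<Phi>P: "\<Phi> (fst P, w) = P" if "w \<in> roots P" for w
    using that by (simp add: roots_def flip: G_iff)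
  define T' where "T' = (\<Inter>w\<in>roots P. V w \<inter> (\<lambda>P'. snd (g w P')) -` (ball w e \<inter> ball 0 r))"
  define T where "T = (U - K) \<inter> T'"
  have oT': "open T'"
    unfolding T'_def
  proof (intro open_INT fin ballI)
    fix w assume w: "w \<in> roots P"
    show "open (V w \<inter> (\<lambda>P'. snd (g w P')) -` (ball w e \<inter> ball 0 r))"
      by (intro continuous_open_preimage continuous_intros shD[OF w]) auto
  qed
  have PT': "P \<in> T'"
    using shD(8,9) sh \<Phi>P e(1) roots_less[of P] P by (fastforce simp: T'_def)
  have T: "P' \<in> V w" "\<Phi> (g w P') = P'" "g w P' \<in> regular_points" "snd (g w P') \<in> ball w e"
    if "P' \<in> T" "w \<in> roots P" for P' w
    using that shD[OF that(2)] by (auto simp: T_def T'_def regular_points_def)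
  \<comment> \<open>The sheets take distinct values among the roots of \<open>\<Phi> Q\<close>, and
    there are as many sheets as roots; so the root \<open>snd Q\<close> is one of these
    values.\<close>
  have fibre: "\<exists>w\<in>roots P. g w (\<Phi> Q) = Q" if "Q \<in> regular_points" "\<Phi> Q \<in> T" for Q
  proof -
    let ?f = "\<lambda>w. snd (g w (\<Phi> Q))"
    have "inj_on ?f (roots P)"
      using T(4)[OF that(2)] e(2) by (intro inj_onI) (metis IntI empty_iff)
    then have "card (?f ` roots P) = card (roots (\<Phi> Q))"
      using card_roots P that(1) by (simp add: card_image regular_points_iff)
    moreover have "?f ` roots P \<subseteq> roots (\<Phi> Q)"
      using T(2,3)[OF that(2)] unfolding regular_points_iff by auto
    ultimately have "?f ` roots P = roots (\<Phi> Q)"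
      using finite_roots that(1) by (intro card_subset_eq) (auto simp: regular_points_iff)
    moreover have "snd Q \<in> roots (\<Phi> Q)" using that(1) by (simp add: regular_points_iff)
    ultimately obtain w where w: "w \<in> roots P" "snd (g w (\<Phi> Q)) = snd Q" by force
    moreover have "fst (g w (\<Phi> Q)) = fst Q"
      using shD(7)[OF w(1) T(1)[OF that(2) w(1)]] by simp
    ultimately show ?thesis by (meson prod_eqI)
  qed
  show "\<exists>T. P \<in> T \<and> openin (top_of_set (U - K)) T \<and>
     (\<exists>v. \<Union>v = regular_points \<inter> \<Phi> -` T \<and> (\<forall>u\<in>v. openin (top_of_set regular_points) u) \<and>
        pairwise disjnt v \<and> (\<forall>u\<in>v. \<exists>q. homeomorphism u T \<Phi> q))"
  proof (intro exI[of _ T] conjI exI[of _ "(\<lambda>w. g w ` T) ` roots P"])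
    show "P \<in> T" using P PT' by (simp add: T_def)
    show "openin (top_of_set (U - K)) T" unfolding T_def using oT' by blast
    show "\<Union> ((\<lambda>w. g w ` T) ` roots P) = regular_points \<inter> \<Phi> -` T"
    proof (intro equalityI subsetI)
      fix Q assume "Q \<in> regular_points \<inter> \<Phi> -` T"
      with fibre[of Q] show "Q \<in> \<Union> ((\<lambda>w. g w ` T) ` roots P)" by (force intro: rev_image_eqI)
    qed (auto simp: T)
    show "\<forall>u\<in>(\<lambda>w. g w ` T) ` roots P. openin (top_of_set regular_points) u"
    proof safe
      fix w assume w: "w \<in> roots P"
      have "g w ` T = regular_points \<inter> (N w \<inter> \<Phi> -` T')"
      proof (intro equalityI subsetI)
        fix Q assume Q: "Q \<in> regular_points \<inter> (N w \<inter> \<Phi> -` T')"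
        then have "\<Phi> Q \<in> T" by (auto simp: T_def regular_points_def)
        moreover have "g w (\<Phi> Q) = Q" using Q shD(8)[OF w] by blast
        ultimately show "Q \<in> g w ` T" by (metis imageI)
      qed (use T w shD(6)[OF w] in \<open>auto simp: T_def\<close>)
      moreover have "open (N w \<inter> \<Phi> -` T')"
        using shD[OF w] oT' by (intro continuous_open_preimage continuous_on_subset[OF continuous_on_\<Phi>])
      ultimately show "openin (top_of_set regular_points) (g w ` T)" by auto
    qed
    show "pairwise disjnt ((\<lambda>w. g w ` T) ` roots P)"
    proof (rule pairwise_imageI)
      fix w w' assume ww: "w \<in> roots P" "w' \<in> roots P" "w \<noteq> w'"
      show "disjnt (g w ` T) (g w' ` T)"
        unfolding disjnt_iff using T(4)[OF _ ww(1)] T(4)[OF _ ww(2)] e(2)[OF ww] by (metis IntI empty_iff imageE)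
    qed
    show "\<forall>u\<in>(\<lambda>w. g w ` T) ` roots P. \<exists>q. homeomorphism u T \<Phi> q"
    proof safe
      fix w assume w: "w \<in> roots P"
      have "homeomorphism (g w ` T) T \<Phi> (g w)"
      proof (rule homeomorphism_of_subsets[OF shD(4)[OF w]])
        show "g w ` T \<subseteq> N w" using T(1) w shD(6)[OF w] by auto
        show "T \<subseteq> V w" using T(1) w by auto
        show "\<Phi> ` (g w ` T) = T" using T(2) w by (force simp: image_image)
      qed
      then show "\<exists>q. homeomorphism (g w ` T) T \<Phi> q" by blast
    qed
  qed
qed

lemma continuation_along_path:
  assumes "Q \<in> regular_points" "local_sheet N V g" "Q \<in> N"
    and c: "path c" "pathstart c = \<Phi> Q" "path_image c \<subseteq> U - K"
  shows "\<exists>F. continuation_along (\<lambda>P. h (snd (g P))) c {0..1} F"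
proof -
  obtain \<gamma> where \<gamma>: "path \<gamma>" "path_image \<gamma> \<subseteq> regular_points" "pathstart \<gamma> = Q"
    "\<And>s. s \<in> {0..1} \<Longrightarrow> \<Phi> (\<gamma> s) = c s"
    using covering_space_lift_path_strong[OF covering_regular assms(1) c(1,3,2)] by metis
  have reg: "\<gamma> s \<in> regular_points" if "s \<in> {0..1}" for s
    using \<gamma>(2) that by (auto simp: path_image_def)
  show ?thesis
    by (rule continuation_along_lift[of "{0..1}" \<gamma> N V g c])
       (use \<gamma> assms reg regular_points_ball jac_nonzero in \<open>auto simp: path_def pathstart_def simp del: mem_ball\<close>)
qed

end

subsection \<open>The critical curve\<close>

text \<open>The even and the odd terms of the Taylor series are power series in the square. The
  formulas by means of \<open>csqrt\<close> do not change when the sign of the root does, so the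
  branch cut leaves no trace.\<close>

lemma holomorphic_even_odd_parts:
  fixes X :: "complex \<Rightarrow> complex"
  assumes X: "X holomorphic_on ball 0 \<rho>" "0 < \<rho>"
  obtains Xe Xo where "Xe holomorphic_on ball 0 (\<rho>\<^sup>2)" "Xo holomorphic_on ball 0 (\<rho>\<^sup>2)"
    "\<And>\<sigma>. X \<sigma> = Xe (\<sigma>\<^sup>2) + \<sigma> * Xo (\<sigma>\<^sup>2)"
proof -
  define c where "c n = (deriv ^^ n) X 0 / fact n" for n
  define Xe where "Xe t = (X (csqrt t) + X (- csqrt t)) / 2" for t
  \<comment> \<open>At 0 the quotient is replaced by its limit, the linear Taylor
    coefficient.\<close>
  define Xo where "Xo t = (if t = 0 then c 1 else (X (csqrt t) - X (- csqrt t)) / (2 * csqrt t))" for t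
  have c: "(\<lambda>n. c n * s ^ n) sums X s" if "s \<in> ball 0 \<rho>" for s
    using holomorphic_power_series[OF X(1) that] by (simp add: c_def)
  have range_even: "odd n" if "n \<notin> range ((*) 2)" for n :: nat
    using that by (metis evenE rangeI)
  have range_odd: "even n" if "n \<notin> range (\<lambda>n. Suc (2 * n))" for n :: nat
    using that by (metis oddE Suc_eq_plus1 rangeI)
  have even: "(\<lambda>n. c (2 * n) * (s\<^sup>2) ^ n) sums ((X s + X (- s)) / 2)" if "s \<in> ball 0 \<rho>" for s
  proof -
    have "(\<lambda>n. (c n * s ^ n + c n * (- s) ^ n) / 2) sums ((X s + X (- s)) / 2)"
      using that by (intro sums_divide sums_add c) auto
    then have "(\<lambda>n. (c (2 * n) * s ^ (2 * n) + c (2 * n) * (- s) ^ (2 * n)) / 2) sums ((X s + X (- s)) / 2)"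
      by (subst (asm) sums_mono_reindex[of "\<lambda>n. 2 * n", symmetric]) (auto simp: strict_mono_def range_even)
    then show ?thesis by (simp add: power_mult)
  qed
  have odd: "(\<lambda>n. c (2 * n + 1) * s ^ (2 * n + 1)) sums ((X s - X (- s)) / 2)" if "s \<in> ball 0 \<rho>" for s
  proof -
    have "(\<lambda>n. (c n * s ^ n - c n * (- s) ^ n) / 2) sums ((X s - X (- s)) / 2)"
      using that by (intro sums_divide sums_diff c) auto
    then have "(\<lambda>n. (c (2 * n + 1) * s ^ (2 * n + 1) - c (2 * n + 1) * (- s) ^ (2 * n + 1)) / 2) sums ((X s - X (- s)) / 2)"
      by (subst (asm) sums_mono_reindex[of "\<lambda>n. 2 * n + 1", symmetric]) (auto simp: strict_mono_def dest!: range_odd)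
    then show ?thesis by (simp add: mult.commute mult.left_commute)
  qed
  have csq: "csqrt t \<in> ball 0 \<rho>" if "t \<in> ball (0::complex) (\<rho>\<^sup>2)" for t
  proof -
    have "(cmod (csqrt t))\<^sup>2 < \<rho>\<^sup>2" using that by (simp flip: norm_power)
    then show ?thesis using X(2) power_less_imp_less_base[of "cmod (csqrt t)" 2 \<rho>] by (simp del: norm_csqrt)
  qed
  show thesis
  proof
    show "Xe holomorphic_on ball 0 (\<rho>\<^sup>2)"
      using even[OF csq] by (intro power_series_holomorphic[of _ _ "\<lambda>n. c (2 * n)"]) (simp add: Xe_def)
    show "Xo holomorphic_on ball 0 (\<rho>\<^sup>2)"
    proof (intro power_series_holomorphic[of _ _ "\<lambda>n. c (2 * n + 1)"])
      fix t :: complex assume t: "t \<in> ball 0 (\<rho>\<^sup>2)"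
      show "(\<lambda>n. c (2 * n + 1) * (t - 0) ^ n) sums Xo t"
      proof (cases "t = 0")
        case True
        then show ?thesis using powser_sums_zero[of "\<lambda>n. c (2 * n + 1)"] by (simp add: Xo_def)
      next
        case False
        have "(\<lambda>n. c (2 * n + 1) * csqrt t ^ (2 * n + 1) / csqrt t) sums ((X (csqrt t) - X (- csqrt t)) / 2 / csqrt t)"
          by (intro sums_divide odd csq t)
        then show ?thesis using False by (simp add: Xo_def power_mult)
      qed
    qed
    fix \<sigma>
    show "X \<sigma> = Xe (\<sigma>\<^sup>2) + \<sigma> * Xo (\<sigma>\<^sup>2)"
    proof (cases "\<sigma> = 0")
      case False
      have "(csqrt (\<sigma>\<^sup>2))\<^sup>2 = \<sigma>\<^sup>2" by simp
      then consider "csqrt (\<sigma>\<^sup>2) = \<sigma>" | "csqrt (\<sigma>\<^sup>2) = - \<sigma>"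
        using power2_eq_iff by blast
      then show ?thesis
        by cases (use False in \<open>auto simp: Xe_def Xo_def field_simps\<close>)
    qed (simp add: Xe_def)
  qed
qed

text \<open>The roots \<open>w\<close> of \<open>3 * w\<^sup>2 = t * deriv h w\<close>, uniformized by \<open>\<sigma>\<close> with \<open>\<sigma>\<^sup>2 = t\<close>. The critical values
  \<open>x = w ^ 3 - t * h w\<close> are then \<open>Xe t \<plusminus> \<sigma> * Xo t\<close>.\<close>

lemma critical_curve:
  fixes h :: "complex \<Rightarrow> complex"
  assumes h: "h holomorphic_on ball 0 R0" "0 < R0" "deriv h 0 = 1"
  obtains R \<rho> W Xe Xo where "0 < R" "R \<le> R0" "0 < \<rho>" "W holomorphic_on ball 0 \<rho>" "W 0 = 0"
    "\<And>\<sigma>. \<sigma> \<in> ball 0 \<rho> \<Longrightarrow> W \<sigma> \<in> ball 0 R"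
    "\<And>\<sigma>. \<sigma> \<in> ball 0 \<rho> \<Longrightarrow> 3 * (W \<sigma>)\<^sup>2 = \<sigma>\<^sup>2 * deriv h (W \<sigma>)"
    "\<And>w t. w \<in> ball 0 R \<Longrightarrow> cmod t < \<rho>\<^sup>2 \<Longrightarrow> 3 * w\<^sup>2 = t * deriv h w \<Longrightarrow> \<exists>\<sigma>\<in>ball 0 \<rho>. \<sigma>\<^sup>2 = t \<and> W \<sigma> = w"
    "Xe holomorphic_on ball 0 (\<rho>\<^sup>2)" "Xo holomorphic_on ball 0 (\<rho>\<^sup>2)"
    "\<And>\<sigma>. \<sigma> \<in> ball 0 \<rho> \<Longrightarrow> W \<sigma> ^ 3 - \<sigma>\<^sup>2 * h (W \<sigma>) = Xe (\<sigma>\<^sup>2) + \<sigma> * Xo (\<sigma>\<^sup>2)"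
    "\<And>\<sigma>. \<sigma> \<in> ball 0 \<rho> \<Longrightarrow> \<sigma> \<noteq> 0 \<Longrightarrow> Xo (\<sigma>\<^sup>2) \<noteq> 0"
    "\<And>\<sigma>. \<sigma> \<in> ball 0 \<rho> \<Longrightarrow>
      2 * \<sigma> * deriv Xe (\<sigma>\<^sup>2) + Xo (\<sigma>\<^sup>2) + 2 * \<sigma>\<^sup>2 * deriv Xo (\<sigma>\<^sup>2) = - 2 * \<sigma> * h (W \<sigma>)"
proof -
  have hd: "deriv h holomorphic_on ball 0 R0" by (intro holomorphic_deriv h open_ball)
  have "isCont (deriv h) 0"
    using hd h(2) by (meson centre_in_ball continuous_on_eq_continuous_at holomorphic_on_imp_continuous_on open_ball)
  \<comment> \<open>A positive real part passes to \<open>3 / deriv h w\<close> and keeps it off the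
    branch cut of \<open>csqrt\<close>.\<close>
  then have "\<forall>\<^sub>F w in nhds 0. deriv h w \<in> {z. 0 < Re z}"
    unfolding isCont_def tendsto_at_iff_tendsto_nhds
    by (rule topological_tendstoD) (auto simp: open_halfspace_Re_gt h(3))
  moreover have "\<forall>\<^sub>F w in nhds 0. w \<in> ball 0 R0"
    using h(2) by (intro eventually_nhds_in_open) auto
  ultimately have "\<forall>\<^sub>F w in nhds (0::complex). 0 < Re (deriv h w) \<and> w \<in> ball 0 R0"
    by eventually_elim auto
  then obtain R1 where R1: "0 < R1" "\<And>w. w \<in> ball 0 R1 \<Longrightarrow> 0 < Re (deriv h w) \<and> w \<in> ball 0 R0"
    unfolding eventually_nhds_metric by (auto simp: dist_commute)
  have nz: "deriv h w \<noteq> 0" if "w \<in> ball 0 R1" for w using R1(2)[OF that] by auto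
  define q where "q w = csqrt (3 / deriv h w)" for w
  have q_holo: "q holomorphic_on ball 0 R1"
  proof -
    have "3 / deriv h w \<notin> \<real>\<^sub>\<le>\<^sub>0" if "w \<in> ball 0 R1" for w
    proof -
      have "0 < Re (3 / deriv h w)"
        using R1(2)[OF that] nz[OF that] by (simp add: Re_divide_numeral Re_divide divide_simps sum_power2_gt_zero_iff complex_eq_iff)
      then show ?thesis by (auto simp: complex_nonpos_Reals_iff)
    qed
    moreover have "deriv h holomorphic_on ball 0 R1"
      using R1(2) by (intro holomorphic_on_subset[OF hd]) blast
    ultimately show ?thesis
      unfolding q_def[abs_def] using nz
      by (intro holomorphic_on_csqrt' holomorphic_on_divide holomorphic_on_const) auto
  qed
  \<comment> \<open>\<open>k\<close> is a holomorphic square root of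
    \<open>3 * w^2 / deriv h w\<close>, so that the critical equation becomes
    \<open>k(w)^2 = t\<close>. Its derivative at 0 is a square root of 3, hence \<open>k\<close> is
    locally invertible, and \<open>W\<close> is its inverse.\<close>
  define k where "k w = w * q w" for w
  have k_holo: "k holomorphic_on ball 0 R1"
    unfolding k_def[abs_def] by (intro holomorphic_intros q_holo)
  have k2: "(k w)\<^sup>2 * deriv h w = 3 * w\<^sup>2" if "w \<in> ball 0 R1" for w
    using nz[OF that] by (simp add: k_def q_def power_mult_distrib)
  have "(q has_field_derivative deriv q 0) (at 0)"
    using q_holo R1(1) holomorphic_derivI by fastforce
  then have "(k has_field_derivative q 0) (at 0)"
    unfolding k_def[abs_def] by (auto intro!: derivative_eq_intros)
  then have "deriv k 0 \<noteq> 0" using h(3) by (simp add: DERIV_imp_deriv q_def)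
  then obtain R where R: "0 < R" "ball 0 R \<subseteq> ball (0::complex) R1" "open (k ` ball 0 R)" "inj_on k (ball 0 R)"
    by (rule has_complex_derivative_locally_invertible[OF k_holo _ open_ball, of 0, rotated]) (use R1(1) in auto)
  have "ball 0 R \<subseteq> ball (0::complex) R0" using subsetD[OF R(2)] conjunct2[OF R1(2)] by blast
  then have R': "R \<le> R0" using R(1) unfolding ball_subset_ball_iff by simp
  obtain W where W: "W holomorphic_on k ` ball 0 R" "\<And>w. w \<in> ball 0 R \<Longrightarrow> deriv k w * deriv W (k w) = 1"
    "\<And>w. w \<in> ball 0 R \<Longrightarrow> W (k w) = w"
    using holomorphic_has_inverse[OF holomorphic_on_subset[OF k_holo R(2)] open_ball R(4)] by metis
  have k0: "k 0 = 0" by (simp add: k_def)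
  then have "0 \<in> k ` ball 0 R" using R(1) by (intro image_eqI[of _ _ 0]) auto
  then obtain \<rho>0 where \<rho>0: "0 < \<rho>0" "ball 0 \<rho>0 \<subseteq> k ` ball 0 R"
    using R(3) open_contains_ball by metis
  have W0: "W 0 = 0" using W(3)[of 0] k0 R(1) by simp
  have W_holo: "W holomorphic_on ball 0 \<rho>0" using W(1) \<rho>0(2) holomorphic_on_subset by blast
  have W_k: "W \<sigma> \<in> ball 0 R \<and> k (W \<sigma>) = \<sigma>" if s: "\<sigma> \<in> ball 0 \<rho>0" for \<sigma>
  proof -
    obtain w where "w \<in> ball 0 R" "\<sigma> = k w" using \<rho>0(2) s by blast
    then show ?thesis using W(3) by simp
  qed
  note W_ball = conjunct1[OF W_k] and k_W = conjunct2[OF W_k]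
  have crit: "3 * (W \<sigma>)\<^sup>2 = \<sigma>\<^sup>2 * deriv h (W \<sigma>)" if "\<sigma> \<in> ball 0 \<rho>0" for \<sigma>
    using k2[of "W \<sigma>"] k_W[OF that] W_ball[OF that] R(2) by auto
  define X where "X \<sigma> = W \<sigma> ^ 3 - \<sigma>\<^sup>2 * h (W \<sigma>)" for \<sigma>
  have hR: "h holomorphic_on ball 0 R"
    using h(1) R' by (auto intro: holomorphic_on_subset)
  have hW: "h \<circ> W holomorphic_on ball 0 \<rho>0"
    using W_ball by (intro holomorphic_on_compose_gen[OF W_holo hR]) blast
  have X_holo: "X holomorphic_on ball 0 \<rho>0"
    using hW unfolding X_def[abs_def] o_def by (intro holomorphic_intros W_holo)
  \<comment> \<open>The factor of \<open>deriv W \<sigma>\<close> vanishes by the critical equation.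
    What remains says \<open>dx/dt = - u\<close> along the curve, which is the characteristic
    direction.\<close>
  have X_deriv: "(X has_field_derivative - 2 * \<sigma> * h (W \<sigma>)) (at \<sigma>)" if s: "\<sigma> \<in> ball 0 \<rho>0" for \<sigma>
  proof -
    have W': "(W has_field_derivative deriv W \<sigma>) (at \<sigma>)"
      using W_holo s holomorphic_derivI by blast
    have h': "(h has_field_derivative deriv h (W \<sigma>)) (at (W \<sigma>))"
      using hR W_ball[OF s] holomorphic_derivI by blast
    have "(X has_field_derivative 3 * (W \<sigma>)\<^sup>2 * deriv W \<sigma> - (2 * \<sigma> * h (W \<sigma>) + \<sigma>\<^sup>2 * (deriv h (W \<sigma>) * deriv W \<sigma>))) (at \<sigma>)"
      unfolding X_def[abs_def]
      by (auto intro!: derivative_eq_intros W' DERIV_chain2[OF h' W'])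
    then show ?thesis unfolding crit[OF s] by (simp add: algebra_simps)
  qed
  obtain Xe Xo where Xeo: "Xe holomorphic_on ball 0 (\<rho>0\<^sup>2)" "Xo holomorphic_on ball 0 (\<rho>0\<^sup>2)"
    "\<And>\<sigma>. X \<sigma> = Xe (\<sigma>\<^sup>2) + \<sigma> * Xo (\<sigma>\<^sup>2)"
    using holomorphic_even_odd_parts[OF X_holo \<rho>0(1)] by metis
  have sq: "\<sigma>\<^sup>2 \<in> ball 0 (\<rho>\<^sup>2) \<longleftrightarrow> \<sigma> \<in> ball 0 \<rho>" if "0 < \<rho>" for \<rho> and \<sigma> :: complex
    using that by (auto simp: norm_power power_strict_mono intro: power_less_imp_less_base)
  have X_deriv2: "2 * \<sigma> * deriv Xe (\<sigma>\<^sup>2) + Xo (\<sigma>\<^sup>2) + 2 * \<sigma>\<^sup>2 * deriv Xo (\<sigma>\<^sup>2) = - 2 * \<sigma> * h (W \<sigma>)"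
    if s: "\<sigma> \<in> ball 0 \<rho>0" for \<sigma>
  proof -
    have e: "(Xe has_field_derivative deriv Xe (\<sigma>\<^sup>2)) (at (\<sigma>\<^sup>2))"
      and o: "(Xo has_field_derivative deriv Xo (\<sigma>\<^sup>2)) (at (\<sigma>\<^sup>2))"
      using Xeo(1,2) s sq[OF \<rho>0(1)] holomorphic_derivI open_ball by blast+
    have s2: "((\<lambda>s. s\<^sup>2) has_field_derivative 2 * \<sigma>) (at \<sigma>)"
      by (auto intro!: derivative_eq_intros)
    have "((\<lambda>\<sigma>. Xe (\<sigma>\<^sup>2) + \<sigma> * Xo (\<sigma>\<^sup>2)) has_field_derivative
        deriv Xe (\<sigma>\<^sup>2) * (2 * \<sigma>) + (1 * Xo (\<sigma>\<^sup>2) + deriv Xo (\<sigma>\<^sup>2) * (2 * \<sigma>) * \<sigma>)) (at \<sigma>)"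
      by (intro DERIV_add DERIV_mult DERIV_ident DERIV_chain2[OF e s2] DERIV_chain2[OF o s2])
    moreover have "X = (\<lambda>\<sigma>. Xe (\<sigma>\<^sup>2) + \<sigma> * Xo (\<sigma>\<^sup>2))" using Xeo(3) by blast
    ultimately have "- 2 * \<sigma> * h (W \<sigma>) = deriv Xe (\<sigma>\<^sup>2) * (2 * \<sigma>) + (1 * Xo (\<sigma>\<^sup>2) + deriv Xo (\<sigma>\<^sup>2) * (2 * \<sigma>) * \<sigma>)"
      using X_deriv[OF s] DERIV_unique by blast
    then show ?thesis by (simp add: algebra_simps power2_eq_square)
  qed
  \<comment> \<open>If \<open>Xo\<close> vanished identically, the derivative identity would make
    \<open>h\<close> composed with \<open>W\<close> even, so its derivative at 0 would vanish; but
    it is \<open>deriv W 0\<close>, which is nonzero since \<open>W\<close> inverts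
    \<open>k\<close>.\<close>
  have "\<exists>\<beta>\<in>ball 0 (\<rho>0\<^sup>2). Xo \<beta> \<noteq> 0"
  proof (rule ccontr)
    assume "\<not> ?thesis"
    then have Xo: "Xo t = 0" if "t \<in> ball 0 (\<rho>0\<^sup>2)" for t using that by blast
    have Xo': "deriv Xo t = 0" if t: "t \<in> ball 0 (\<rho>0\<^sup>2)" for t
    proof -
      have "((\<lambda>_. 0) has_field_derivative (0::complex)) (at t)" by (rule DERIV_const)
      then have "(Xo has_field_derivative 0) (at t)"
        by (rule has_field_derivative_transform_within_open[OF _ open_ball t]) (simp only: Xo)
      then show ?thesis by (rule DERIV_imp_deriv)
    qed
    have "h (W \<sigma>) = - deriv Xe (\<sigma>\<^sup>2)" if s: "\<sigma> \<in> ball 0 \<rho>0" "\<sigma> \<noteq> 0" for \<sigma>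
    proof -
      have s2: "\<sigma>\<^sup>2 \<in> ball 0 (\<rho>0\<^sup>2)" using sq[OF \<rho>0(1)] s(1) by blast
      have "2 * \<sigma> * (deriv Xe (\<sigma>\<^sup>2) + h (W \<sigma>)) = 0"
        using X_deriv2[OF s(1)] unfolding Xo[OF s2] Xo'[OF s2] by algebra
      then show ?thesis using s(2) by (simp add: eq_neg_iff_add_eq_0 add.commute)
    qed
    then have even: "(h \<circ> W) \<sigma> = (h \<circ> W) (- \<sigma>)" if "\<sigma> \<in> ball 0 \<rho>0" for \<sigma>
      using that by (cases "\<sigma> = 0") auto
    let ?d = "deriv (h \<circ> W) 0"
    have d: "(h \<circ> W has_field_derivative ?d) (at 0)"
      using hW \<rho>0(1) by (intro holomorphic_derivI[OF hW open_ball]) auto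
    have "((\<lambda>\<sigma>. (h \<circ> W) (- \<sigma>)) has_field_derivative ?d * - 1) (at 0)"
      by (rule DERIV_chain2[where g = uminus]) (use d in \<open>auto intro!: derivative_eq_intros simp: o_def\<close>)
    then have "((\<lambda>\<sigma>. (h \<circ> W) (- \<sigma>)) has_field_derivative - ?d) (at 0)" by simp
    moreover have "0 \<in> ball (0::complex) \<rho>0" using \<rho>0(1) by simp
    ultimately have "(h \<circ> W has_field_derivative - ?d) (at 0)"
      by (rule has_field_derivative_transform_within_open[OF _ open_ball]) (rule even[symmetric])
    with d have "?d = - ?d" by (rule DERIV_unique)
    then have "?d = 0" by simp
    moreover have "(h \<circ> W has_field_derivative deriv h (W 0) * deriv W 0) (at 0)"
      using holomorphic_derivI[OF hR open_ball, of "W 0"] holomorphic_derivI[OF W_holo open_ball, of 0]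
        R(1) \<rho>0(1) W0 by (intro DERIV_chain) auto
    ultimately have "deriv W 0 = 0" using DERIV_imp_deriv[of "h \<circ> W"] W0 h(3) by simp
    then show False using W(2)[of 0] k0 R(1) by simp
  qed
  then obtain \<beta> where \<beta>: "\<beta> \<in> ball 0 (\<rho>0\<^sup>2)" "Xo \<beta> \<noteq> 0" by blast
  \<comment> \<open>At \<open>t = 0\<close> the two critical values coincide. As zeros of
    \<open>Xo\<close> are isolated, they differ for all other small \<open>t\<close>.\<close>
  have "Xo 0 = 0" using X_deriv2[of 0] \<rho>0(1) by simp
  then obtain e where e: "0 < e" "\<And>z. z \<in> ball 0 e - {0} \<Longrightarrow> Xo z \<noteq> 0"
    by (rule isolated_zeros[OF Xeo(2) open_ball connected_ball _ _ \<beta>, rotated]) (use \<rho>0(1) in auto)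
  \<comment> \<open>The square root of \<open>e\<close> puts \<open>\<sigma>^2\<close> into the disc
    of radius \<open>e\<close> where 0 is the only zero of \<open>Xo\<close>.\<close>
  define \<rho> where "\<rho> = min \<rho>0 (sqrt e)"
  have \<rho>: "0 < \<rho>" "\<rho> \<le> \<rho>0" "\<rho>\<^sup>2 \<le> e" "\<rho>\<^sup>2 \<le> \<rho>0\<^sup>2"
  proof -
    show "0 < \<rho>" "\<rho> \<le> \<rho>0" using \<rho>0(1) e(1) by (auto simp: \<rho>_def)
    then show "\<rho>\<^sup>2 \<le> \<rho>0\<^sup>2" by (intro power_mono) auto
    have "\<rho>\<^sup>2 \<le> (sqrt e)\<^sup>2" using \<open>0 < \<rho>\<close> by (intro power_mono) (auto simp: \<rho>_def)
    then show "\<rho>\<^sup>2 \<le> e" using e(1) by simp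
  qed
  have sub: "ball 0 \<rho> \<subseteq> ball (0::complex) \<rho>0" using \<rho>(2) by auto
  show thesis
  proof (rule that[of R \<rho> W Xe Xo])
    show "\<exists>\<sigma>\<in>ball 0 \<rho>. \<sigma>\<^sup>2 = t \<and> W \<sigma> = w" if w: "w \<in> ball 0 R" "cmod t < \<rho>\<^sup>2" "3 * w\<^sup>2 = t * deriv h w" for w t
    proof (intro bexI conjI)
      have w1: "w \<in> ball 0 R1" using R(2) w(1) by blast
      have "(k w)\<^sup>2 * deriv h w = t * deriv h w" using k2[OF w1] w(3) by simp
      then show kt: "(k w)\<^sup>2 = t" using nz[OF w1] by simp
      show "W (k w) = w" using W(3) w by blast
      show "k w \<in> ball 0 \<rho>" using sq[OF \<rho>(1), of "k w"] w(2) unfolding kt by simp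
    qed
    show "Xe holomorphic_on ball 0 (\<rho>\<^sup>2)" "Xo holomorphic_on ball 0 (\<rho>\<^sup>2)"
      using Xeo(1,2) \<rho>(4) by (auto intro: holomorphic_on_subset)
    show "Xo (\<sigma>\<^sup>2) \<noteq> 0" if "\<sigma> \<in> ball 0 \<rho>" "\<sigma> \<noteq> 0" for \<sigma>
      using e(2)[of "\<sigma>\<^sup>2"] that sq[OF \<rho>(1), of \<sigma>] \<rho>(3) by auto
    show "W \<sigma> ^ 3 - \<sigma>\<^sup>2 * h (W \<sigma>) = Xe (\<sigma>\<^sup>2) + \<sigma> * Xo (\<sigma>\<^sup>2)" for \<sigma>
      using Xeo(3)[of \<sigma>] by (simp add: X_def)
  qed (use R R' W0 \<rho>(1) W_holo W_ball crit X_deriv2 sub in \<open>auto intro: holomorphic_on_subset\<close>)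
qed

subsection \<open>Constancy along characteristics\<close>

lemma holomorphic2_on_slice_x:
  assumes "holomorphic2_on v W" "open W" "\<And>y. y \<in> S \<Longrightarrow> (a, y) \<in> W" "open S"
  shows "(\<lambda>y. v (a, y)) holomorphic_on S"
proof -
  have "((\<lambda>y. v (a, y)) has_field_derivative deriv_x v (a, y)) (at y)" if "y \<in> S" for y
  proof -
    have "((\<lambda>y. (a, y)) has_derivative (\<lambda>d. (0, d))) (at y)"
      by (auto intro!: derivative_eq_intros)
    from has_derivative_compose[OF this holomorphic2_on_has_derivative[OF assms(1,2) assms(3)[OF that]]]
    show ?thesis by (simp add: has_field_derivative_def)
  qed
  then show ?thesis using assms(4) by (auto simp: holomorphic_on_open)
qed

text \<open>\<open>holomorphic2_on\<close> asserts only that derivatives exist. A local bound for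
  \<open>v\<close>, which is continuous, gives one for its derivative by Cauchy's inequality on the
  discs of radius \<open>e / 4\<close> in the \<open>x\<close>-direction.\<close>

lemma deriv_x_locally_bounded:
  assumes v: "holomorphic2_on v W" "open W" "P \<in> W"
  obtains C where "\<forall>\<^sub>F Q in nhds P. cmod (deriv_x v Q) \<le> C"
proof -
  have "isCont v P"
    using holomorphic2_on_imp_continuous_on[OF v(1)] v(2,3) continuous_on_eq_continuous_at by blast
  then have "(v \<longlongrightarrow> v P) (nhds P)"
    unfolding isCont_def using tendsto_at_iff_tendsto_nhds by metis
  then have "\<forall>\<^sub>F Q in nhds P. v Q \<in> ball 0 (cmod (v P) + 1)"
    by (rule topological_tendstoD) auto
  moreover have "\<forall>\<^sub>F Q in nhds P. Q \<in> W"
    using v by (intro eventually_nhds_in_open)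
  ultimately have "\<forall>\<^sub>F Q in nhds P. Q \<in> W \<and> cmod (v Q) \<le> cmod (v P) + 1"
    by eventually_elim auto
  then obtain e where e: "0 < e" "\<And>Q. dist Q P < e \<Longrightarrow> Q \<in> W \<and> cmod (v Q) \<le> cmod (v P) + 1"
    unfolding eventually_nhds_metric by blast
  have near: "dist (fst Q, y) P < e" if "dist Q P < e / 2" "cmod (snd Q - y) < e / 2" for Q y
  proof -
    have "dist (fst Q, y) Q = cmod (snd Q - y)"
      by (simp add: dist_prod_def dist_commute[of y] dist_norm norm_minus_commute)
    then show ?thesis using dist_triangle[of "(fst Q, y)" P Q] that by simp
  qed
  have "cmod (deriv_x v Q) \<le> (cmod (v P) + 1) / (e / 4)" if Q: "dist Q P < e / 2" for Q
  proof -
    have holo: "(\<lambda>y. v (fst Q, y)) holomorphic_on ball (snd Q) (e / 2)"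
      using e(2) near[OF Q] by (intro holomorphic2_on_slice_x[OF v(1,2)]) (auto simp: dist_norm)
    have "cmod ((deriv ^^ 1) (\<lambda>y. v (fst Q, y)) (snd Q)) \<le> fact 1 * (cmod (v P) + 1) / (e / 4) ^ 1"
    proof (rule Cauchy_inequality)
      show "(\<lambda>y. v (fst Q, y)) holomorphic_on ball (snd Q) (e / 4)"
        using e(1) by (intro holomorphic_on_subset[OF holo]) auto
      show "continuous_on (cball (snd Q) (e / 4)) (\<lambda>y. v (fst Q, y))"
        using e(1) by (intro continuous_on_subset[OF holomorphic_on_imp_continuous_on[OF holo]]) auto
      show "cmod (v (fst Q, y)) \<le> cmod (v P) + 1" if "cmod (snd Q - y) = e / 4" for y
        using e near[OF Q, of y] that by simp
    qed (use e(1) in auto)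
    then show ?thesis by (simp add: deriv_x_def)
  qed
  then have "\<forall>\<^sub>F Q in nhds P. cmod (deriv_x v Q) \<le> (cmod (v P) + 1) / (e / 4)"
    unfolding eventually_nhds_metric using e(1) by (intro exI[of _ "e / 2"]) simp
  then show thesis by (rule that)
qed

text \<open>With \<open>M\<close> the maximum of \<open>cmod f\<close> on a disc of radius
  \<open>e\<close>, the equation and \<open>f 0 = 0\<close> give \<open>M \<le> C * e * M\<close>,
  so \<open>M = 0\<close> once \<open>C * e < 1\<close>. The identity theorem carries this to the
  whole disc; of \<open>g\<close>, only a bound near 0 is used.\<close>

lemma linear_ode_zero:
  fixes f g :: "complex \<Rightarrow> complex"
  assumes f: "\<And>s. s \<in> ball 0 \<rho> \<Longrightarrow> (f has_field_derivative f s * g s) (at s)" "f 0 = 0"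
    and g: "\<forall>\<^sub>F s in nhds 0. cmod (g s) \<le> C" and s: "s \<in> ball 0 \<rho>"
  shows "f s = 0"
proof -
  have \<rho>: "0 < \<rho>" using s by (auto intro: le_less_trans[OF norm_ge_zero])
  have holo: "f holomorphic_on ball 0 \<rho>"
    using f(1) by (meson holomorphic_on_open open_ball)
  obtain e0 where e0: "0 < e0" "\<And>s. cmod s < e0 \<Longrightarrow> cmod (g s) \<le> C"
    using g unfolding eventually_nhds_metric by auto
  then have "0 \<le> C" using norm_ge_zero[of "g 0"] by (metis norm_zero order_trans)
  \<comment> \<open>The three terms stay inside the region where \<open>g\<close> is bounded, stay
    inside the domain of \<open>f\<close>, and give \<open>C * e < 1\<close>; \<open>C + 1\<close>
    keeps the quotient meaningful for \<open>C = 0\<close>.\<close>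
  define e where "e = min (min (e0 / 2) (\<rho> / 2)) (1 / (2 * (C + 1)))"
  have e: "0 < e" "e < e0" "e < \<rho>" "C * e < 1"
  proof -
    show "0 < e" "e < e0" "e < \<rho>" using \<rho> e0(1) \<open>0 \<le> C\<close> by (auto simp: e_def min_def)
    have "C * e \<le> C * (1 / (2 * (C + 1)))" using \<open>0 \<le> C\<close> by (intro mult_left_mono) (auto simp: e_def)
    also have "\<dots> < 1" using \<open>0 \<le> C\<close> by (simp add: field_simps)
    finally show "C * e < 1" .
  qed
  have sub: "cball 0 e \<subseteq> ball (0::complex) \<rho>" using e(3) by auto
  have "continuous_on (cball 0 e) (\<lambda>s. cmod (f s))"
    using holo sub by (intro continuous_on_norm) (meson continuous_on_subset holomorphic_on_imp_continuous_on)
  then obtain m where m: "m \<in> cball 0 e" "\<And>s. s \<in> cball 0 e \<Longrightarrow> cmod (f s) \<le> cmod (f m)"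
    using continuous_attains_sup[of "cball 0 e" "\<lambda>s. cmod (f s)"] e(1) by auto
  have "cmod (f m - f 0) \<le> (cmod (f m) * C) * cmod (m - 0)"
  proof (rule field_differentiable_bound[of "cball 0 e" f "\<lambda>s. f s * g s"])
    fix s :: complex assume s: "s \<in> cball 0 e"
    then show "(f has_field_derivative f s * g s) (at s within cball 0 e)"
      using f(1) sub has_field_derivative_at_within by blast
    show "cmod (f s * g s) \<le> cmod (f m) * C"
      unfolding norm_mult using m(2)[OF s] e0(2)[of s] s e(2) by (intro mult_mono) auto
  qed (use m(1) e(1) in auto)
  also have "\<dots> \<le> (cmod (f m) * C) * e"
    using m(1) \<open>0 \<le> C\<close> by (intro mult_left_mono) auto
  finally have "cmod (f m) * (1 - C * e) \<le> 0" using f(2) by (simp add: algebra_simps)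
  then have "cmod (f m) \<le> 0" using e(4) by (simp add: mult_le_0_iff)
  then have "f s = 0" if "s \<in> ball 0 e" for s using m(2)[of s] that by simp
  then show ?thesis
    using analytic_continuation_open[of "ball 0 e" "ball 0 \<rho>" f "\<lambda>_. 0" s] e(1,3) s holo
      ball_subset_cball sub by (auto simp: subset_iff)
qed

text \<open>A solution is constant along the line \<open>x = y - t * v (0, y)\<close>: there, the difference \<open>f\<close> of \<open>v\<close> and
  its initial value solves the linear equation \<open>f' = f * v\<^sub>x\<close>.\<close>

lemma burgers_characteristic:
  assumes v: "holomorphic2_on v W" "open W"
    and pde: "\<And>P. P \<in> W \<Longrightarrow> deriv_t v P = v P * deriv_x v P"
    and line: "\<And>s. s \<in> ball 0 \<rho> \<Longrightarrow> (s, y - s * v (0, y)) \<in> W" and t: "t \<in> ball 0 \<rho>"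
  shows "v (t, y - t * v (0, y)) = v (0, y)"
proof -
  define c where "c = v (0, y)"
  define l where "l s = (s, y - s * c)" for s
  define f where "f s = v (l s) - c" for s
  have l': "(l has_derivative (\<lambda>d. (d, - c * d))) (at s)" for s
    unfolding l_def[abs_def] by (auto intro!: derivative_eq_intros simp: algebra_simps)
  have f': "(f has_field_derivative (f s * deriv_x v (l s))) (at s)" if "s \<in> ball 0 \<rho>" for s
  proof -
    have "l s \<in> W" using line[OF that] by (simp add: l_def c_def)
    note has_derivative_compose[OF l' holomorphic2_on_has_derivative[OF v this]]
    then have "((\<lambda>s. v (l s)) has_derivative (\<lambda>d. deriv_t v (l s) * d + deriv_x v (l s) * (- c * d))) (at s)"
      by (simp add: split_beta)
    \<comment> \<open>Along the line the derivative is \<open>v_t - c * v_x\<close>, which equals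
      \<open>(v - c) * v_x\<close> by the equation.\<close>
    then have "((\<lambda>s. v (l s)) has_field_derivative (f s * deriv_x v (l s))) (at s)"
      unfolding has_field_derivative_def
      by (rule has_derivative_eq_rhs) (auto simp: pde[OF \<open>l s \<in> W\<close>] f_def algebra_simps)
    then show ?thesis unfolding f_def[abs_def] by (auto intro!: derivative_eq_intros)
  qed
  have "l 0 \<in> W" using line[of 0] t by (auto simp: l_def c_def intro: le_less_trans[OF norm_ge_zero])
  then obtain C where C: "\<forall>\<^sub>F Q in nhds (l 0). cmod (deriv_x v Q) \<le> C"
    using deriv_x_locally_bounded[OF v] by metis
  have "isCont l 0" using l'[of 0] has_derivative_continuous by blast
  then have "filterlim l (nhds (l 0)) (nhds 0)"
    unfolding isCont_def using tendsto_at_iff_tendsto_nhds by metis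
  then have "\<forall>\<^sub>F s in nhds 0. cmod (deriv_x v (l s)) \<le> C"
    using C by (rule eventually_compose_filterlim[rotated])
  then have "f t = 0"
    by (intro linear_ode_zero[OF f' _ _ t]) (auto simp: f_def l_def c_def)
  then show ?thesis by (simp add: f_def l_def c_def)
qed

subsection \<open>The characteristic hypersurface\<close>

text \<open>The zeros of \<open>H\<close> are countable, and a connected open plane set minus a
  countable set is path connected. The last piece is a segment in a disc around \<open>b\<close>
  that holds no other zero.\<close>

lemma path_avoiding_zeros:
  fixes H :: "complex \<Rightarrow> complex"
  assumes H: "H holomorphic_on \<Lambda>" "open \<Lambda>" "connected \<Lambda>" and a: "a \<in> \<Lambda>" "H a \<noteq> 0" and b: "b \<in> \<Lambda>" "H b = 0"
  obtains c where "path c" "pathstart c = a" "pathfinish c = b" "path_image c \<subseteq> \<Lambda>"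
    "\<And>s. s \<in> {0..<1} \<Longrightarrow> H (c s) \<noteq> 0"
proof -
  obtain e where e: "0 < e" "ball b e \<subseteq> \<Lambda>" "\<And>z. z \<in> ball b e - {b} \<Longrightarrow> H z \<noteq> 0"
    using isolated_zeros[OF H b a] by blast
  define b1 where "b1 = b + of_real (e / 2)"
  have b1: "b1 \<in> ball b e" "b1 \<noteq> b"
    using e(1) by (auto simp: b1_def dist_norm)
  have "\<not> H constant_on \<Lambda>"
    using a b unfolding constant_on_def by metis
  \<comment> \<open>A countable union of compact sets: this is the form in which countability of the
    zeros is available.\<close>
  moreover have "fsigma \<Lambda>"
  proof -
    obtain C :: "nat \<Rightarrow> complex set" where "\<And>n. compact (C n)" "\<Union> (range C) = \<Lambda>"
      using open_Union_compact_subsets[OF H(2)] by metis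
    then show ?thesis using fsigma.intros[of C] compact_imp_closed by auto
  qed
  ultimately have "countable {z\<in>\<Lambda>. H z = 0}"
    using H by (intro holomorphic_countable_zeros)
  then have "path_connected (\<Lambda> - {z\<in>\<Lambda>. H z = 0})"
    using H by (intro path_connected_open_diff_countable) auto
  moreover have "H b1 \<noteq> 0" "b1 \<in> \<Lambda>"
    by (rule e(3), rule DiffI[OF b1(1)], simp add: b1(2), rule subsetD[OF e(2) b1(1)])
  then have "a \<in> \<Lambda> - {z\<in>\<Lambda>. H z = 0}" "b1 \<in> \<Lambda> - {z\<in>\<Lambda>. H z = 0}"
    using a by simp_all
  ultimately have "\<exists>p. path p \<and> path_image p \<subseteq> \<Lambda> - {z\<in>\<Lambda>. H z = 0} \<and> pathstart p = a \<and> pathfinish p = b1"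
    unfolding path_connected_def by blast
  then obtain p where p: "path p" "path_image p \<subseteq> \<Lambda> - {z\<in>\<Lambda>. H z = 0}" "pathstart p = a" "pathfinish p = b1"
    by blast
  let ?l = "linepath b1 b"
  have l: "?l s \<in> ball b e" if "s \<in> {0..1}" for s
  proof -
    have "?l s \<in> closed_segment b1 b" using that by (auto simp: linepath_in_path)
    also have "\<dots> \<subseteq> ball b e" using b1(1) e(1) by (intro closed_segment_subset) auto
    finally show ?thesis .
  qed
  have l_ne: "?l s \<noteq> b" if "s < 1" for s
  proof -
    have "?l s - b = (1 - s) *\<^sub>R (b1 - b)" by (simp add: linepath_def algebra_simps)
    then show ?thesis using b1(2) that by auto
  qed
  show thesis
  proof (rule that[of "p +++ ?l"])
    show "path (p +++ ?l)" "pathstart (p +++ ?l) = a" "pathfinish (p +++ ?l) = b"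
      using p by auto
    have "path_image ?l \<subseteq> \<Lambda>" using l e(2) by (auto simp: path_image_def)
    then show "path_image (p +++ ?l) \<subseteq> \<Lambda>" using p(2) by (intro subset_path_image_join) auto
    fix s :: real assume s: "s \<in> {0..<1}"
    show "H ((p +++ ?l) s) \<noteq> 0"
    proof (cases "s \<le> 1/2")
      case True
      then have "p (2 * s) \<in> path_image p" using s by (auto simp: path_image_def)
      then show ?thesis using True p(2) by (auto simp: joinpaths_def)
    next
      case False
      then have "?l (2 * s - 1) \<in> ball b e - {b}" using s l[of "2 * s - 1"] l_ne[of "2 * s - 1"] by auto
      then show ?thesis using False e(3) by (simp add: joinpaths_def)
    qed
  qed
qed

text \<open>Adds the critical curve to the surface. The second radius \<open>r2\<close> is chosen so
  that the whole bidisc \<open>cmod t < \<rho>^2\<close>, \<open>cmod w < r2\<close> projects into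
  \<open>U\<close>; it contains the critical points, so that complex lines can be drawn in
  it.\<close>

locale burgers_discriminant = burgers_surface h R r "\<rho>\<^sup>2" \<epsilon> B
  for h :: "complex \<Rightarrow> complex" and R r \<rho> \<epsilon> B :: real +
  fixes W Xe Xo :: "complex \<Rightarrow> complex" and r2 :: real
  assumes \<rho>_pos: "0 < \<rho>" and r2: "0 < r2" "r2 < r" "r2 ^ 3 + \<rho>\<^sup>2 * B < \<epsilon>"
    and W_0: "W 0 = 0" and W_small: "\<And>\<sigma>. \<sigma> \<in> ball 0 \<rho> \<Longrightarrow> cmod (W \<sigma>) < r2"
    and W_crit: "\<And>\<sigma>. \<sigma> \<in> ball 0 \<rho> \<Longrightarrow> 3 * (W \<sigma>)\<^sup>2 = \<sigma>\<^sup>2 * deriv h (W \<sigma>)"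
    and crit_W: "\<And>w t. w \<in> ball 0 R \<Longrightarrow> cmod t < \<rho>\<^sup>2 \<Longrightarrow> 3 * w\<^sup>2 = t * deriv h w \<Longrightarrow>
      \<exists>\<sigma>\<in>ball 0 \<rho>. \<sigma>\<^sup>2 = t \<and> W \<sigma> = w"
    and Xe_holo: "Xe holomorphic_on ball 0 (\<rho>\<^sup>2)" and Xo_holo: "Xo holomorphic_on ball 0 (\<rho>\<^sup>2)"
    and X_eq: "\<And>\<sigma>. \<sigma> \<in> ball 0 \<rho> \<Longrightarrow> W \<sigma> ^ 3 - \<sigma>\<^sup>2 * h (W \<sigma>) = Xe (\<sigma>\<^sup>2) + \<sigma> * Xo (\<sigma>\<^sup>2)"
    and Xo_nonzero: "\<And>\<sigma>. \<sigma> \<in> ball 0 \<rho> \<Longrightarrow> \<sigma> \<noteq> 0 \<Longrightarrow> Xo (\<sigma>\<^sup>2) \<noteq> 0"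
    and X_deriv: "\<And>\<sigma>. \<sigma> \<in> ball 0 \<rho> \<Longrightarrow>
      2 * \<sigma> * deriv Xe (\<sigma>\<^sup>2) + Xo (\<sigma>\<^sup>2) + 2 * \<sigma>\<^sup>2 * deriv Xo (\<sigma>\<^sup>2) = - 2 * \<sigma> * h (W \<sigma>)"
begin

text \<open>The product of \<open>x - (Xe t + \<sigma> * Xo t)\<close> over the two square roots \<open>\<sigma>\<close> of \<open>t\<close>.\<close>

definition S :: "complex \<times> complex \<Rightarrow> complex" where
  "S P = (snd P - Xe (fst P))\<^sup>2 - fst P * (Xo (fst P))\<^sup>2"

section \<open>The critical set as the zero set of \<open>S\<close>\<close>

lemma U_iff: "P \<in> U \<longleftrightarrow> cmod (fst P) < \<rho>\<^sup>2 \<and> cmod (snd P) < \<epsilon>"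
  by (auto simp: U_def mem_Times_iff)

lemma Xe_0: "Xe 0 = 0"
  using X_eq[of 0] \<rho>_pos W_0 by simp

lemma square_in_ball: "cmod (\<sigma>\<^sup>2) < \<rho>\<^sup>2 \<Longrightarrow> \<sigma> \<in> ball 0 \<rho>"
  using \<rho>_pos power_less_imp_less_base[of "cmod \<sigma>" 2 \<rho>] by (simp add: norm_power)

lemma W_ball: "\<sigma> \<in> ball 0 \<rho> \<Longrightarrow> W \<sigma> \<in> ball 0 R"
  using W_small[of \<sigma>] r2 r_less by simp

lemma K_cases:
  assumes "P \<in> K"
  obtains \<sigma> where "\<sigma> \<in> ball 0 \<rho>" "P = (\<sigma>\<^sup>2, Xe (\<sigma>\<^sup>2) + \<sigma> * Xo (\<sigma>\<^sup>2))" "P = \<Phi> (\<sigma>\<^sup>2, W \<sigma>)"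
proof -
  obtain w where w: "P \<in> U" "w \<in> roots P" "jac (fst P, w) = 0" using assms by (auto simp: K_def)
  then obtain \<sigma> where \<sigma>: "\<sigma> \<in> ball 0 \<rho>" "\<sigma>\<^sup>2 = fst P" "W \<sigma> = w"
    using crit_W[of w "fst P"] by (auto simp: roots_def U_iff jac_def)
  have "P = \<Phi> (\<sigma>\<^sup>2, W \<sigma>)" using w(2) G_iff \<sigma> by (auto simp: roots_def)
  then show thesis using that[OF \<sigma>(1)] X_eq[OF \<sigma>(1)] by (simp add: \<Phi>_def)
qed

lemma S_critical: "\<sigma> \<in> ball 0 \<rho> \<Longrightarrow> S (\<sigma>\<^sup>2, Xe (\<sigma>\<^sup>2) + \<sigma> * Xo (\<sigma>\<^sup>2)) = 0"
  by (simp add: S_def power_mult_distrib)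

lemma critical_in_K:
  assumes "\<sigma> \<in> ball 0 \<rho>" "(\<sigma>\<^sup>2, Xe (\<sigma>\<^sup>2) + \<sigma> * Xo (\<sigma>\<^sup>2)) \<in> U"
  shows "(\<sigma>\<^sup>2, Xe (\<sigma>\<^sup>2) + \<sigma> * Xo (\<sigma>\<^sup>2)) \<in> K"
proof -
  have "G (\<sigma>\<^sup>2, Xe (\<sigma>\<^sup>2) + \<sigma> * Xo (\<sigma>\<^sup>2)) (W \<sigma>) = 0" "jac (\<sigma>\<^sup>2, W \<sigma>) = 0"
    using X_eq[OF assms(1)] W_crit[OF assms(1)] by (auto simp: G_def jac_def)
  then show ?thesis using assms(2) W_ball[OF assms(1)] by (force simp: K_def roots_def)
qed

text \<open>With \<open>s\<close> a square root of \<open>t\<close>, \<open>S\<close> splits into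
  two linear factors in \<open>x\<close>. The second arises from the first by replacing
  \<open>s\<close> with \<open>- s\<close>, so each zero is the critical value of one of the two
  parameters.\<close>

lemma K_eq: "K = {P \<in> U. S P = 0}"
proof (intro equalityI subsetI)
  fix P assume P: "P \<in> K"
  then have "P \<in> U" by (simp add: K_def)
  moreover obtain \<sigma> where "\<sigma> \<in> ball 0 \<rho>" "P = (\<sigma>\<^sup>2, Xe (\<sigma>\<^sup>2) + \<sigma> * Xo (\<sigma>\<^sup>2))"
    using P by (rule K_cases)
  ultimately show "P \<in> {P \<in> U. S P = 0}" using S_critical by simp
next
  fix P assume P: "P \<in> {P \<in> U. S P = 0}"
  define s where "s = csqrt (fst P)"
  have s2: "s\<^sup>2 = fst P" by (simp add: s_def)
  have "(snd P - Xe (s\<^sup>2))\<^sup>2 = (s * Xo (s\<^sup>2))\<^sup>2"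
    using P by (simp add: S_def s2 power_mult_distrib)
  then consider "snd P - Xe (s\<^sup>2) = s * Xo (s\<^sup>2)" | "snd P - Xe (s\<^sup>2) = - (s * Xo (s\<^sup>2))"
    using power2_eq_iff by blast
  then obtain \<sigma> where \<sigma>: "\<sigma>\<^sup>2 = fst P" "snd P = Xe (\<sigma>\<^sup>2) + \<sigma> * Xo (\<sigma>\<^sup>2)"
  proof cases
    case 1 then show thesis using that[of s] s2 by (simp add: algebra_simps)
  next
    case 2 then show thesis using that[of "- s"] s2 by (simp add: algebra_simps)
  qed
  then have "P = (\<sigma>\<^sup>2, Xe (\<sigma>\<^sup>2) + \<sigma> * Xo (\<sigma>\<^sup>2))" by (simp add: prod_eq_iff)
  moreover have "\<sigma> \<in> ball 0 \<rho>" using P \<sigma>(1) by (intro square_in_ball) (auto simp: U_iff)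
  ultimately show "P \<in> K" using critical_in_K P by auto
qed

lemma K_initial: "(0, x) \<in> U \<Longrightarrow> (0, x) \<in> K \<longleftrightarrow> x = 0"
  by (simp add: K_eq S_def Xe_0)

lemma S_holo: "holomorphic2_on S U"
proof -
  have "fst ` U \<subseteq> ball 0 (\<rho>\<^sup>2)" by (auto simp: U_def)
  then show ?thesis unfolding S_def[abs_def]
    by (intro holomorphic2_intros holomorphic2_on_compose[OF Xe_holo open_ball]
        holomorphic2_on_compose[OF Xo_holo open_ball])
qed

lemma S_derivs:
  assumes "cmod t < \<rho>\<^sup>2"
  shows "deriv_x S (t, x) = 2 * (x - Xe t)"
    "deriv_t S (t, x) = - 2 * (x - Xe t) * deriv Xe t - (Xo t)\<^sup>2 - 2 * t * Xo t * deriv Xo t"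
proof -
  have e: "(Xe has_field_derivative deriv Xe t) (at t)" and o: "(Xo has_field_derivative deriv Xo t) (at t)"
    using Xe_holo Xo_holo assms by (auto intro: holomorphic_derivI)
  show "deriv_x S (t, x) = 2 * (x - Xe t)"
    unfolding deriv_x_def S_def
    by (rule DERIV_imp_deriv) (auto intro!: derivative_eq_intros)
  show "deriv_t S (t, x) = - 2 * (x - Xe t) * deriv Xe t - (Xo t)\<^sup>2 - 2 * t * Xo t * deriv Xo t"
    unfolding deriv_t_def S_def
    by (rule DERIV_imp_deriv) (auto intro!: derivative_eq_intros e o simp: algebra_simps power2_eq_square)
qed

text \<open>At the critical value, \<open>S_x = 2 * \<sigma> * Xo\<close> and \<open>S_t\<close> is
  \<open>- Xo\<close> times the derivative of the critical value in \<open>\<sigma>\<close>, which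
  is \<open>- 2 * \<sigma> * h (W \<sigma>)\<close>.\<close>

lemma S_characteristic:
  assumes "\<sigma> \<in> ball 0 \<rho>"
  defines "P \<equiv> (\<sigma>\<^sup>2, Xe (\<sigma>\<^sup>2) + \<sigma> * Xo (\<sigma>\<^sup>2))"
  shows "deriv_t S P - h (W \<sigma>) * deriv_x S P = 0"
proof -
  have t: "cmod (\<sigma>\<^sup>2) < \<rho>\<^sup>2" using assms \<rho>_pos by (simp add: norm_power power_strict_mono)
  show ?thesis unfolding P_def S_derivs[OF t] using X_deriv[OF assms(1)] by algebra
qed

text \<open>For \<open>\<sigma> \<noteq> 0\<close> the \<open>x\<close>-derivative
  \<open>2 * \<sigma> * Xo\<close> is nonzero. The remaining point, the origin, is the limit of such
  points as \<open>\<sigma>\<close> tends to 0.\<close>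

lemma S_reduced: "K \<subseteq> closure {P \<in> K. deriv_t S P \<noteq> 0 \<or> deriv_x S P \<noteq> 0}"
proof
  let ?A = "{P \<in> K. deriv_t S P \<noteq> 0 \<or> deriv_x S P \<noteq> 0}"
  define f where "f \<sigma> = (\<sigma>\<^sup>2, Xe (\<sigma>\<^sup>2) + \<sigma> * Xo (\<sigma>\<^sup>2))" for \<sigma>
  have reg: "f \<sigma> \<in> ?A" if "\<sigma> \<in> ball 0 \<rho>" "\<sigma> \<noteq> 0" "f \<sigma> \<in> U" for \<sigma>
  proof -
    have t: "cmod (\<sigma>\<^sup>2) < \<rho>\<^sup>2" using that \<rho>_pos by (simp add: norm_power power_strict_mono)
    have "deriv_x S (f \<sigma>) \<noteq> 0"
      unfolding f_def S_derivs[OF t] using Xo_nonzero[OF that(1,2)] that(2) by simp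
    moreover have "f \<sigma> \<in> K" using critical_in_K[OF that(1)] that(3) unfolding f_def by simp
    ultimately show ?thesis by simp
  qed
  fix P assume "P \<in> K"
  then obtain \<sigma> where \<sigma>: "\<sigma> \<in> ball 0 \<rho>" "P = f \<sigma>" unfolding f_def by (rule K_cases)
  have "P \<in> U" using \<open>P \<in> K\<close> unfolding K_def by blast
  show "P \<in> closure ?A"
  proof (cases "\<sigma> = 0")
    case False
    have "f \<sigma> \<in> ?A"
      by (rule reg[OF \<sigma>(1) False]) (use \<open>P \<in> U\<close> \<sigma>(2) in simp)
    then show ?thesis unfolding \<sigma>(2) by (rule subsetD[OF closure_subset])
  next
    case True
    have "isCont Xe 0" "isCont Xo 0"
      using \<rho>_pos holomorphic_on_imp_continuous_on[OF Xe_holo] holomorphic_on_imp_continuous_on[OF Xo_holo]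
      by (simp_all add: continuous_on_eq_continuous_at)
    then have "isCont f 0"
      unfolding f_def[abs_def]
      by (intro isCont_Pair isCont_add isCont_mult isCont_o2[of 0 "\<lambda>\<sigma>. \<sigma>\<^sup>2" Xe] isCont_o2[of 0 "\<lambda>\<sigma>. \<sigma>\<^sup>2" Xo]
          continuous_power continuous_ident) simp_all
    then have lim: "(f \<longlongrightarrow> P) (at 0)" using \<sigma>(2) True by (simp add: isCont_def)
    have "\<forall>\<^sub>F \<sigma> in at 0. f \<sigma> \<in> U"
      using lim open_U \<open>P \<in> U\<close> by (rule topological_tendstoD)
    moreover have "\<forall>\<^sub>F \<sigma> in at 0. \<sigma> \<in> ball 0 \<rho> - {0}"
      using \<rho>_pos by (auto simp: eventually_at dist_commute)
    ultimately have "\<forall>\<^sub>F \<sigma> in at 0. f \<sigma> \<in> closure ?A"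
    proof eventually_elim
      case (elim \<sigma>)
      then have "f \<sigma> \<in> ?A" by (intro reg) simp_all
      then show ?case by (rule subsetD[OF closure_subset])
    qed
    then show ?thesis
      using lim by (intro Lim_in_closed_set[OF closed_closure _ _ lim]) auto
  qed
qed

section \<open>Branches of the solution that end on the critical set\<close>

lemma bidisc_in_U:
  assumes "cmod (fst Q) < \<rho>\<^sup>2" "cmod (snd Q) < r2" shows "\<Phi> Q \<in> U"
proof -
  have "cmod (fst Q * h (snd Q)) \<le> \<rho>\<^sup>2 * B"
    unfolding norm_mult using assms h_bound[of "snd Q"] r2 r_less by (intro mult_mono) auto
  moreover have "cmod (snd Q ^ 3) \<le> r2 ^ 3"
    unfolding norm_power using assms by (intro power_mono) auto
  ultimately have "cmod (snd (\<Phi> Q)) < \<epsilon>"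
    using norm_triangle_ineq4[of "snd Q ^ 3" "fst Q * h (snd Q)"] r2(3) by (simp add: \<Phi>_def)
  then show ?thesis using assms by (simp add: U_iff)
qed

lemma initial_root_less:
  assumes "(0, w ^ 3) \<in> U" shows "cmod w < r"
proof -
  have "\<epsilon> < r ^ 3" using small mult_nonneg_nonneg[OF zero_le_power2 B_nonneg, of \<rho>] by linarith
  then have "cmod w ^ 3 < r ^ 3" using assms by (simp add: U_iff norm_power)
  then show ?thesis using r_pos power_less_imp_less_base[of "cmod w" 3 r] by simp
qed

lemma initial_regular:
  assumes "w \<noteq> 0" "(0, w ^ 3) \<in> U" shows "(0, w) \<in> regular_points"
  using assms K_initial[OF assms(2)] initial_root_less[OF assms(2)]
  by (simp add: regular_points_def \<Phi>_def)

text \<open>The points of \<open>K\<close> are reached upstairs: first shrink \<open>w0\<close> at \<open>t = 0\<close>, then follow a complex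
  line to the critical point, off the isolated zeros of \<open>S \<circ> \<Phi>\<close> on that line.\<close>

lemma path_to_critical:
  assumes w0: "w0 \<noteq> 0" "(0, w0 ^ 3) \<in> U" and \<sigma>: "\<sigma> \<in> ball 0 \<rho>"
  obtains \<gamma> where "path \<gamma>" "pathstart \<gamma> = (0, w0)" "pathfinish \<gamma> = (\<sigma>\<^sup>2, W \<sigma>)"
    "\<And>s. s \<in> {0..<1} \<Longrightarrow> \<gamma> s \<in> regular_points"
proof -
  \<comment> \<open>Brings \<open>w0\<close> radially into the disc of radius \<open>r2\<close>; the
    minimum with 1 ensures that it is never enlarged, so the first segment stays over
    \<open>U\<close>.\<close>
  define \<kappa> where "\<kappa> = min 1 (r2 / (2 * cmod w0))"
  have \<kappa>: "0 < \<kappa>" "\<kappa> \<le> 1" "\<kappa> * cmod w0 < r2"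
  proof -
    show "0 < \<kappa>" "\<kappa> \<le> 1" using w0(1) r2 by (auto simp: \<kappa>_def)
    have "\<kappa> * cmod w0 \<le> r2 / (2 * cmod w0) * cmod w0" by (intro mult_right_mono) (auto simp: \<kappa>_def)
    then show "\<kappa> * cmod w0 < r2" using w0(1) r2(1) by simp
  qed
  define w1 where "w1 = of_real \<kappa> * w0"
  define t ws where "t = \<sigma>\<^sup>2" and "ws = W \<sigma>"
  have t: "cmod t < \<rho>\<^sup>2" using \<sigma> \<rho>_pos by (simp add: t_def norm_power power_strict_mono)
  have w1: "cmod w1 < r2" "w1 \<noteq> 0" using \<kappa> w0 by (auto simp: w1_def norm_mult)
  define line where "line l = (l * t, w1 + l * (ws - w1))" for l
  \<comment> \<open>The complex parameters for which the line stays in the bidisc. It is a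
    two-real-dimensional convex set, which leaves room to go around the zeros of
    \<open>H\<close>.\<close>
  define \<Lambda> where "\<Lambda> = (\<lambda>l. l * t) -` ball 0 (\<rho>\<^sup>2) \<inter> (\<lambda>l. w1 + l * (ws - w1)) -` ball 0 r2"
  have "open \<Lambda>" unfolding \<Lambda>_def by (intro open_Int open_vimage continuous_intros) auto
  have "convex \<Lambda>"
  proof -
    have "convex ((\<lambda>l. l * t) -` ball 0 (\<rho>\<^sup>2))"
      by (intro convex_linear_vimage convex_ball bounded_linear.linear bounded_linear_mult_left)
    moreover have "(\<lambda>l. w1 + l * (ws - w1)) -` ball 0 r2 = (\<lambda>l. l * (ws - w1)) -` ball (- w1) r2"
      by (auto simp: dist_norm norm_minus_commute algebra_simps)
    then have "convex ((\<lambda>l. w1 + l * (ws - w1)) -` ball 0 r2)"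
      by (simp only:) (intro convex_linear_vimage convex_ball bounded_linear.linear bounded_linear_mult_left)
    ultimately show ?thesis unfolding \<Lambda>_def by (rule convex_Int)
  qed
  have \<Lambda>: "cmod (l * t) < \<rho>\<^sup>2" "cmod (w1 + l * (ws - w1)) < r2" if "l \<in> \<Lambda>" for l
    using that by (auto simp: \<Lambda>_def)
  define H where "H l = S (\<Phi> (line l))" for l
  have H_holo: "H holomorphic_on \<Lambda>"
  proof -
    have "(\<lambda>l. Xe (l * t)) holomorphic_on \<Lambda>" "(\<lambda>l. Xo (l * t)) holomorphic_on \<Lambda>"
      "(\<lambda>l. h (w1 + l * (ws - w1))) holomorphic_on \<Lambda>"
      using \<Lambda> r2 r_less
      by (intro holomorphic_on_compose_gen[unfolded o_def, OF _ Xe_holo]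
            holomorphic_on_compose_gen[unfolded o_def, OF _ Xo_holo]
            holomorphic_on_compose_gen[unfolded o_def, OF _ h_holo] holomorphic_intros; force)+
    then show ?thesis
      unfolding H_def[abs_def] S_def \<Phi>_def line_def fst_conv snd_conv by (intro holomorphic_intros)
  qed
  \<comment> \<open>\<open>H 0 = w1 ^ 6\<close>, because \<open>S (0, x) = x^2\<close>; so
    \<open>H\<close> does not vanish identically.\<close>
  have "0 \<in> \<Lambda>" "H 0 \<noteq> 0"
    using \<rho>_pos w1 by (auto simp: \<Lambda>_def H_def line_def \<Phi>_def S_def Xe_0)
  moreover have "1 \<in> \<Lambda>" using t W_small[OF \<sigma>] by (auto simp: \<Lambda>_def ws_def)
  moreover have "H 1 = 0"
    using S_critical[OF \<sigma>] X_eq[OF \<sigma>] by (simp add: H_def line_def \<Phi>_def t_def ws_def)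
  ultimately obtain c where c: "path c" "pathstart c = 0" "pathfinish c = 1" "path_image c \<subseteq> \<Lambda>"
    "\<And>s. s \<in> {0..<1} \<Longrightarrow> H (c s) \<noteq> 0"
    using path_avoiding_zeros[OF H_holo \<open>open \<Lambda>\<close> convex_connected[OF \<open>convex \<Lambda>\<close>]] by metis
  have line_reg: "line (c s) \<in> regular_points" if "s \<in> {0..<1}" for s
  proof -
    have "c s \<in> \<Lambda>" using c(4) that by (auto simp: path_image_def)
    then have "\<Phi> (line (c s)) \<in> U" "cmod (snd (line (c s))) < r"
      using \<Lambda>[of "c s"] r2 bidisc_in_U[of "line (c s)"] by (auto simp: line_def)
    then show ?thesis using c(5)[OF that] by (simp add: regular_points_def K_eq H_def)
  qed
  define p where "p = linepath (0 :: complex, w0) (0, w1)"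
  have p_reg: "p s \<in> regular_points" if "s \<in> {0..1}" for s
  proof -
    define m where "m = (1 - s) + s * \<kappa>"
    have m: "0 < m" "m \<le> 1"
    proof -
      have "m = 1 - s * (1 - \<kappa>)" by (simp add: m_def algebra_simps)
      moreover have "0 \<le> s * (1 - \<kappa>)" using that \<kappa> by simp
      moreover have "s * (1 - \<kappa>) \<le> 1 * (1 - \<kappa>)" using that \<kappa> by (intro mult_right_mono) auto
      ultimately show "0 < m" "m \<le> 1" using \<kappa> by auto
    qed
    have "p s = (0, of_real m * w0)"
      by (simp add: p_def linepath_def m_def w1_def scaleR_conv_of_real algebra_simps)
    moreover have "(0, (of_real m * w0) ^ 3) \<in> U"
    proof -
      have "cmod ((of_real m * w0) ^ 3) \<le> 1 ^ 3 * cmod (w0 ^ 3)"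
        using m unfolding norm_power norm_mult power_mult_distrib
        by (intro mult_right_mono power_mono) auto
      then show ?thesis using w0(2) by (simp add: U_iff)
    qed
    ultimately show ?thesis using m w0 initial_regular[of "of_real m * w0"] by auto
  qed
  show thesis
  proof (rule that[of "p +++ (line \<circ> c)"])
    have "path (line \<circ> c)"
      using c(1) unfolding line_def[abs_def] o_def path_def by (intro continuous_intros)
    moreover have "pathstart (line \<circ> c) = (0, w1)" "pathfinish (line \<circ> c) = (t, ws)"
      using c by (auto simp: pathstart_compose pathfinish_compose line_def)
    ultimately show "path (p +++ (line \<circ> c))" "pathstart (p +++ (line \<circ> c)) = (0, w0)"
      "pathfinish (p +++ (line \<circ> c)) = (\<sigma>\<^sup>2, W \<sigma>)"
      by (auto simp: p_def t_def ws_def)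
    fix s :: real assume "s \<in> {0..<1}"
    then show "(p +++ (line \<circ> c)) s \<in> regular_points"
      using p_reg[of "2 * s"] line_reg[of "2 * s - 1"] by (auto simp: joinpaths_def)
  qed
qed

text \<open>Sheets exist only before the end of the lifted path, but the values of the branch are
  \<open>h (snd (\<gamma> s))\<close>, and this is continuous up to the critical point.\<close>

lemma branch_limit_critical:
  assumes w0: "w0 \<noteq> 0" "(0, w0 ^ 3) \<in> U" and sheet: "local_sheet N V g" "(0, w0) \<in> N"
    and \<sigma>: "\<sigma> \<in> ball 0 \<rho>"
  shows "branch_limit (\<lambda>P. h (snd (g P))) (0, w0 ^ 3) U K (\<Phi> (\<sigma>\<^sup>2, W \<sigma>)) (h (W \<sigma>))"
proof -
  obtain \<gamma> where \<gamma>: "path \<gamma>" "pathstart \<gamma> = (0, w0)" "pathfinish \<gamma> = (\<sigma>\<^sup>2, W \<sigma>)"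
    "\<And>s. s \<in> {0..<1} \<Longrightarrow> \<gamma> s \<in> regular_points"
    using path_to_critical[OF w0 \<sigma>] by blast
  have cont: "continuous_on {0..1} \<gamma>" using \<gamma>(1) by (simp add: path_def)
  have img: "snd (\<gamma> s) \<in> ball 0 R" if "s \<in> {0..1}" for s
  proof (cases "s = 1")
    case True
    then show ?thesis using \<gamma>(3) W_ball[OF \<sigma>] by (simp add: pathfinish_def)
  next
    case False
    then show ?thesis using that \<gamma>(4)[of s] regular_points_ball by simp
  qed
  obtain F where F: "continuation_along (\<lambda>P. h (snd (g P))) (\<Phi> \<circ> \<gamma>) {0..<1} F"
    "\<And>s. s \<in> {0..<1} \<Longrightarrow> F s ((\<Phi> \<circ> \<gamma>) s) = h (snd (\<gamma> s))"
  proof (rule continuation_along_lift[of "{0..<1}" \<gamma> N V g "\<Phi> \<circ> \<gamma>"])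
    show "continuous_on {0..<1} \<gamma>" using cont by (rule continuous_on_subset) auto
    show "\<gamma> 0 \<in> N" using \<gamma>(2) sheet(2) by (simp add: pathstart_def)
  qed (use \<gamma>(4) jac_nonzero regular_points_ball sheet(1) in \<open>auto simp del: mem_ball\<close>)
  have "continuous_on {0..1} (\<Phi> \<circ> \<gamma>)"
  proof (rule continuous_on_compose[OF cont continuous_on_subset[OF continuous_on_\<Phi>]])
    show "\<gamma> ` {0..1} \<subseteq> UNIV \<times> ball 0 R" using img by (simp add: image_subset_iff mem_Times_iff)
  qed
  moreover have "continuous_on {0..1} (\<lambda>s. h (snd (\<gamma> s)))"
    using img by (intro continuous_on_compose2[OF holomorphic_on_imp_continuous_on[OF h_holo]]
        continuous_intros cont) auto
  then have "((\<lambda>s. h (snd (\<gamma> s))) \<longlongrightarrow> h (snd (\<gamma> 1))) (at 1 within {0..1})"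
    unfolding continuous_on_def by simp
  then have "((\<lambda>s. h (snd (\<gamma> s))) \<longlongrightarrow> h (W \<sigma>)) (at 1 within {0..1})"
    using \<gamma>(3) by (simp add: pathfinish_def)
  then have "((\<lambda>s. h (snd (\<gamma> s))) \<longlongrightarrow> h (W \<sigma>)) (at_left 1)"
    by (simp add: at_within_Icc_at_left)
  then have "((\<lambda>s. F s ((\<Phi> \<circ> \<gamma>) s)) \<longlongrightarrow> h (W \<sigma>)) (at_left 1)"
    by (rule Lim_transform_eventually) (use F(2) in \<open>auto intro!: eventually_at_leftI[of 0]\<close>)
  ultimately show ?thesis
    unfolding branch_limit_def using F(1) \<gamma>
    by (intro exI[of _ "\<Phi> \<circ> \<gamma>"] exI[of _ F])
       (auto simp: path_def pathstart_def pathfinish_def \<Phi>_def[of "(0, w0)"] regular_points_def)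
qed

end

subsection \<open>The Cauchy problem\<close>

lemma continuous_eq_at_centre:
  fixes f g :: "complex \<Rightarrow> complex"
  assumes "continuous_on (ball 0 e) f" "continuous_on (ball 0 e) g" "0 < e"
    and eq: "\<And>x. x \<in> ball 0 e \<Longrightarrow> x \<noteq> 0 \<Longrightarrow> f x = g x"
  shows "f 0 = g 0"
proof -
  have "isCont f 0" "isCont g 0"
    using assms(1-3) by (simp_all add: continuous_on_eq_continuous_at)
  then have fg: "f \<midarrow>0\<rightarrow> f 0" "g \<midarrow>0\<rightarrow> g 0" by (simp_all add: isCont_def)
  have "\<forall>\<^sub>F x in at 0. f x = g x"
    using \<open>0 < e\<close> eq by (auto simp: eventually_at dist_commute intro!: exI[of _ e])
  then have "g \<midarrow>0\<rightarrow> f 0"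
    by (rule Lim_transform_eventually[OF fg(1)])
  then show ?thesis
    using fg(2) by (rule LIM_unique)
qed

text \<open>Up to here \<open>h\<close> was an arbitrary bounded holomorphic function; only now does
  \<open>w\<close> become a cube root of \<open>x\<close> at \<open>t = 0\<close> and
  \<open>h w\<close> the given datum.\<close>

locale ramified_datum = burgers_discriminant +
  fixes a0 :: "complex \<Rightarrow> complex"
  assumes h_eq: "\<And>w. w \<in> ball 0 R \<Longrightarrow> h w = a0 (w ^ 3) + w"
    and a0_cont: "continuous_on (ball 0 \<epsilon>) a0"
begin

text \<open>At \<open>t = 0\<close> the three values of \<open>u\<close> are \<open>a0 x + w\<close>
  with \<open>w\<close> the cube roots of \<open>x\<close>. Hence their mean is \<open>a0 x\<close>,
  and the centred values satisfy \<open>z ^ 3 = x\<close>.\<close>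

lemma initial_coeffs_punctured:
  assumes x: "(0, x) \<in> U" "x \<noteq> 0"
  shows "avg (0, x) = a0 x" "lin_coeff (0, x) = 0" "const_coeff (0, x) = x"
proof -
  have reg: "(0, x) \<in> U - K" using x K_initial by simp
  obtain w1 w2 w3 where w: "roots (0, x) = {w1, w2, w3}" "w1 \<noteq> w2" "w1 \<noteq> w3" "w2 \<noteq> w3"
    using card_roots[OF reg] by (auto simp: card_3_iff)
  have r: "w ^ 3 = x \<and> h w = a0 x + w" if "w \<in> {w1, w2, w3}" for w
  proof -
    have "w \<in> roots (0, x)" using w that by simp
    then have "w ^ 3 = x" "w \<in> ball 0 R" by (auto simp: roots_def G_def)
    then show ?thesis using h_eq[of w] by simp
  qed
  have sums: "w1 + w2 + w3 = 0" "w1\<^sup>2 + w2\<^sup>2 + w3\<^sup>2 = 0"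
    using distinct_cube_roots[of w1 x w2 w3] r w by auto
  have ps: "psum k (0, x) = (a0 x + w1) ^ k + (a0 x + w2) ^ k + (a0 x + w3) ^ k" for k
    using psum_eq[OF reg, of k] w r by (simp add: algebra_simps)
  have "psum 1 (0, x) = 3 * a0 x + (w1 + w2 + w3)"
    unfolding ps by (simp add: algebra_simps)
  then have 1: "psum 1 (0, x) = 3 * a0 x" unfolding sums by simp
  have "psum 2 (0, x) = 3 * (a0 x)\<^sup>2 + 2 * a0 x * (w1 + w2 + w3) + (w1\<^sup>2 + w2\<^sup>2 + w3\<^sup>2)"
    unfolding ps by (simp add: algebra_simps power2_eq_square)
  then have 2: "psum 2 (0, x) = 3 * (a0 x)\<^sup>2" unfolding sums by simp
  have "psum 3 (0, x) = 3 * a0 x ^ 3 + 3 * (a0 x)\<^sup>2 * (w1 + w2 + w3) + 3 * a0 x * (w1\<^sup>2 + w2\<^sup>2 + w3\<^sup>2)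
      + (w1 ^ 3 + w2 ^ 3 + w3 ^ 3)"
    unfolding ps by (simp add: algebra_simps power2_eq_square power3_eq_cube)
  then have 3: "psum 3 (0, x) = 3 * a0 x ^ 3 + 3 * x" unfolding sums using r by simp
  show avg: "avg (0, x) = a0 x" using 1 by (simp add: avg_def)
  show "lin_coeff (0, x) = 0" unfolding lin_coeff_def avg 2 by simp
  show "const_coeff (0, x) = x"
    unfolding const_coeff_def avg 2 3 by (simp add: power2_eq_square power3_eq_cube)
qed

text \<open>The origin lies on \<open>K\<close>, where the power sums have not been identified with
  sums over roots; the values there follow by continuity.\<close>

lemma initial_coeffs:
  assumes "(0, x) \<in> U"
  shows "avg (0, x) = a0 x" "lin_coeff (0, x) = 0" "const_coeff (0, x) = x"
proof -
  have U: "(0, y) \<in> U \<longleftrightarrow> y \<in> ball 0 \<epsilon>" for y using \<rho>_pos by (simp add: U_iff)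
  have cont: "continuous_on (ball 0 \<epsilon>) (\<lambda>y. f (0, y))" if "holomorphic2_on f U" for f
    by (rule continuous_on_compose2[OF holomorphic2_on_imp_continuous_on[OF that]])
       (auto intro!: continuous_intros simp: U simp del: mem_ball)
  have "avg (0, 0) = a0 0" "lin_coeff (0, 0) = 0" "const_coeff (0, 0) = 0"
    using \<epsilon>_pos initial_coeffs_punctured
      continuous_eq_at_centre[OF cont[OF avg_holo] a0_cont]
      continuous_eq_at_centre[OF cont[OF lin_coeff_holo] continuous_on_const]
      continuous_eq_at_centre[OF cont[OF const_coeff_holo] continuous_on_id]
    by (auto simp: U simp del: mem_ball)
  then show "avg (0, x) = a0 x" "lin_coeff (0, x) = 0" "const_coeff (0, x) = x"
    using initial_coeffs_punctured[OF assms] by (cases "x = 0"; simp)+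
qed

section \<open>The solution germ at a base point, for a chosen branch of the cube root\<close>

context
  fixes b :: "complex \<Rightarrow> complex" and x0 :: complex and N V g
  assumes x0: "x0 \<noteq> 0" "(0, x0) \<in> U" and b: "cube_root_branch b x0"
    and sheet: "local_sheet N V g" "(0, b x0) \<in> N"
begin

lemma branch_at: "b x0 ^ 3 = x0" "b x0 \<noteq> 0"
proof -
  show "b x0 ^ 3 = x0"
    using b eventually_nhds_x_imp_x unfolding cube_root_branch_def by blast
  then show "b x0 \<noteq> 0" using x0 by auto
qed

lemma \<Phi>_initial: "\<Phi> (0, w) = (0, w ^ 3)"
  by (simp add: \<Phi>_def)

lemma tendsto_branch: "(b \<longlongrightarrow> b x0) (nhds x0)"
proof -
  have "isCont b x0"
    using b unfolding cube_root_branch_def by (blast intro: analytic_at_imp_isCont)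
  then show ?thesis unfolding isCont_def using tendsto_at_iff_tendsto_nhds by metis
qed

lemma eventually_sheet: "\<forall>\<^sub>F Q in nhds (0, b x0). Q \<in> N"
  using local_sheetD(1)[OF sheet(1)] sheet(2) by (rule eventually_nhds_in_open)

lemma sheet_initial: "\<forall>\<^sub>F x in nhds x0. g (0, x) = (0, b x)"
proof -
  have "((\<lambda>x. (0, b x)) \<longlongrightarrow> (0, b x0)) (nhds x0)"
    by (intro tendsto_intros tendsto_branch)
  then have "\<forall>\<^sub>F x in nhds x0. (0, b x) \<in> N"
    using eventually_sheet by (rule eventually_compose_filterlim[rotated])
  moreover have "\<forall>\<^sub>F x in nhds x0. b x ^ 3 = x" using b by (simp add: cube_root_branch_def)
  ultimately show ?thesis
  proof eventually_elim
    case (elim x)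
    then show ?case using local_sheetD(8)[OF sheet(1) elim(1)] by (simp add: \<Phi>_initial)
  qed
qed

lemma base_in_V: "(0, x0) \<in> V"
  using local_sheetD(9)[OF sheet] by (simp add: \<Phi>_initial branch_at)

lemma g_base: "g (0, x0) = (0, b x0)"
  using eventually_nhds_x_imp_x[OF sheet_initial] .

lemma tendsto_g: "(g \<longlongrightarrow> (0, b x0)) (nhds (0, x0))"
proof -
  have "isCont g (0, x0)"
    using local_sheetD(2,10)[OF sheet(1)] base_in_V continuous_on_eq_continuous_at by blast
  then show ?thesis unfolding isCont_def g_base using tendsto_at_iff_tendsto_nhds g_base by metis
qed

lemma eventually_regular: "\<forall>\<^sub>F P in nhds (0, x0). P \<in> U - K \<and> snd (g P) \<in> roots P"
proof -
  have "open (U - K)"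
  proof -
    have "U - K = U \<inter> S -` (- {0})" by (auto simp: K_eq)
    moreover have "open (U \<inter> S -` (- {0}))"
      using open_U S_holo by (intro continuous_open_preimage holomorphic2_on_imp_continuous_on) auto
    ultimately show ?thesis by simp
  qed
  moreover have "(0, x0) \<in> U - K" using x0 K_initial by simp
  ultimately have "\<forall>\<^sub>F P in nhds (0, x0). P \<in> U - K" by (rule eventually_nhds_in_open)
  moreover have "\<forall>\<^sub>F P in nhds (0, x0). P \<in> V"
    using local_sheetD(2)[OF sheet(1)] base_in_V by (rule eventually_nhds_in_open)
  ultimately show ?thesis
  proof eventually_elim
    case (elim P)
    have "G P (snd (g P)) = 0"
      using local_sheetD(5,7)[OF sheet(1) elim(2)] by (metis G_iff prod.collapse)
    then show ?case using elim local_sheetD(11)[OF sheet(1) elim(2)] by (simp add: roots_def)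
  qed
qed

lemma sheet_cauchy_germ: "burgers_cauchy_germ a0 b x0 (\<lambda>P. h (snd (g P)))"
  unfolding burgers_cauchy_germ_def
proof (intro conjI)
  have V: "open V" using local_sheetD(2)[OF sheet(1)] .
  show "holomorphic2_near (\<lambda>P. h (snd (g P))) (0, x0)"
    unfolding holomorphic2_near_def using V base_in_V sheet_holomorphic[OF sheet(1)] by blast
  show "\<forall>\<^sub>F P in nhds (0, x0). deriv_t (\<lambda>P. h (snd (g P))) P - h (snd (g P)) * deriv_x (\<lambda>P. h (snd (g P))) P = 0"
    using eventually_nhds_in_open[OF V base_in_V] by eventually_elim (rule sheet_burgers[OF sheet(1)])
  have "\<forall>\<^sub>F x in nhds x0. b x \<in> ball 0 R"
  proof (rule topological_tendstoD[OF tendsto_branch])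
    show "b x0 \<in> ball 0 R" using sheet(2) local_sheetD(3)[OF sheet(1)] by auto
  qed simp
  moreover have "\<forall>\<^sub>F x in nhds x0. b x ^ 3 = x" using b by (simp add: cube_root_branch_def)
  ultimately show "\<forall>\<^sub>F x in nhds x0. h (snd (g (0, x))) = a0 x + b x"
    using sheet_initial
  proof eventually_elim
    case (elim x)
    then show ?case using h_eq[of "b x"] by simp
  qed
qed

text \<open>With \<open>w = snd (g P)\<close>, the surface equation says that \<open>P\<close> lies
  on the line \<open>x = w ^ 3 - t * h w\<close>. As \<open>v (0, w ^ 3) = h w\<close>, this is the
  characteristic of \<open>v\<close> issuing from \<open>(0, w ^ 3)\<close>, so
  \<open>v P = h w\<close>.\<close>

lemma sheet_unique:
  assumes v: "burgers_cauchy_germ a0 b x0 v"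
  shows "\<forall>\<^sub>F P in nhds (0, x0). v P = h (snd (g P))"
proof -
  obtain W1 where W1: "open W1" "(0, x0) \<in> W1" "holomorphic2_on v W1"
    using v by (auto simp: burgers_cauchy_germ_def holomorphic2_near_def)
  obtain W2 where W2: "open W2" "(0, x0) \<in> W2" "\<And>P. P \<in> W2 \<Longrightarrow> deriv_t v P - v P * deriv_x v P = 0"
    using v unfolding burgers_cauchy_germ_def eventually_nhds by blast
  define W where "W = W1 \<inter> W2"
  have W: "open W" "(0, x0) \<in> W" "holomorphic2_on v W"
    using W1 W2 by (auto simp: W_def intro: holomorphic2_on_subset)
  have pde: "deriv_t v P = v P * deriv_x v P" if "P \<in> W" for P
    using W2(3)[of P] that by (simp add: W_def)
  have "isCont v (0, x0)"
    using holomorphic2_on_imp_continuous_on[OF W(3)] W(1,2) continuous_on_eq_continuous_at by blast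
  then have v_lim: "(v \<longlongrightarrow> v (0, x0)) (nhds (0, x0))"
    unfolding isCont_def using tendsto_at_iff_tendsto_nhds by metis
  have fst_lim: "(fst \<longlongrightarrow> 0) (nhds (0 :: complex, x0))" and snd_lim: "(snd \<longlongrightarrow> x0) (nhds (0 :: complex, x0))"
    by (auto intro: tendsto_fst[where a = "(0, x0)", simplified] tendsto_snd[where a = "(0, x0)", simplified] filterlim_ident)
  have "((\<lambda>Q. (0, snd Q)) \<longlongrightarrow> (0, x0)) (nhds (0 :: complex, x0))"
    by (intro tendsto_intros snd_lim)
  then have "((\<lambda>Q. v (0, snd Q)) \<longlongrightarrow> v (0, x0)) (nhds (0 :: complex, x0))"
    by (rule filterlim_compose[OF v_lim])
  \<comment> \<open>Continuity in time and starting point jointly yields one \<open>e\<close> for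
    which all characteristics starting near \<open>x0\<close> stay in \<open>W\<close> for times
    below \<open>e / 2\<close>.\<close>
  then have "((\<lambda>Q. (fst Q, snd Q - fst Q * v (0, snd Q))) \<longlongrightarrow> (0, x0 - 0 * v (0, x0))) (nhds (0, x0))"
    by (intro tendsto_intros fst_lim snd_lim)
  then have "\<forall>\<^sub>F Q in nhds (0, x0). (fst Q, snd Q - fst Q * v (0, snd Q)) \<in> W"
    using W(1,2) by (intro topological_tendstoD) auto
  then obtain e where e: "0 < e" "\<And>Q. dist Q (0, x0) < e \<Longrightarrow> (fst Q, snd Q - fst Q * v (0, snd Q)) \<in> W"
    unfolding eventually_nhds_metric by blast
  have line: "(s, y - s * v (0, y)) \<in> W" if "s \<in> ball 0 (e / 2)" "dist y x0 < e / 2" for s y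
  proof -
    have "dist (s, y) (0, x0) \<le> dist s 0 + dist y x0"
      unfolding dist_Pair_Pair by (rule sqrt_sum_squares_le_sum) auto
    then show ?thesis using e(2)[of "(s, y)"] that by (simp add: dist_commute)
  qed
  have w_lim: "((\<lambda>P. snd (g P)) \<longlongrightarrow> b x0) (nhds (0, x0))"
    using tendsto_snd[OF tendsto_g] by simp
  then have y_lim: "((\<lambda>P. snd (g P) ^ 3) \<longlongrightarrow> x0) (nhds (0, x0))"
    using tendsto_power[OF w_lim, of 3] branch_at by simp
  have "\<forall>\<^sub>F P in nhds (0, x0). (0, snd (g P)) \<in> N"
    by (rule eventually_compose_filterlim[OF eventually_sheet]) (intro tendsto_intros w_lim)
  moreover have "\<forall>\<^sub>F P in nhds (0, x0). g (0, snd (g P) ^ 3) = (0, b (snd (g P) ^ 3))"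
    by (rule eventually_compose_filterlim[OF sheet_initial y_lim])
  moreover have "\<forall>\<^sub>F P in nhds (0, x0). v (0, snd (g P) ^ 3) = a0 (snd (g P) ^ 3) + b (snd (g P) ^ 3)"
    using v by (intro eventually_compose_filterlim[OF _ y_lim, where P = "\<lambda>y. v (0, y) = a0 y + b y"])
      (simp add: burgers_cauchy_germ_def)
  moreover have "\<forall>\<^sub>F P in nhds (0, x0). dist (snd (g P) ^ 3) x0 < e / 2"
    using y_lim e(1) by (intro tendstoD) auto
  moreover have "\<forall>\<^sub>F P in nhds (0 :: complex, x0). fst P \<in> ball 0 (e / 2)"
    by (rule topological_tendstoD[OF fst_lim]) (use e(1) in auto)
  moreover have "\<forall>\<^sub>F P in nhds (0, x0). P \<in> V"
    using local_sheetD(2)[OF sheet(1)] base_in_V by (rule eventually_nhds_in_open)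
  ultimately show ?thesis
  proof eventually_elim
    case (elim P)
    define w where "w = snd (g P)"
    have w_ball: "w \<in> ball 0 R" using local_sheetD(11)[OF sheet(1) elim(6)] by (simp add: w_def)
    have "g (0, w ^ 3) = (0, w)"
      using local_sheetD(8)[OF sheet(1) elim(1)] by (simp add: \<Phi>_initial w_def)
    then have "b (w ^ 3) = w" using elim(2) by (simp add: w_def)
    then have init: "v (0, w ^ 3) = h w" using elim(3) h_eq[OF w_ball] by (simp add: w_def)
    have P: "P = (fst P, w ^ 3 - fst P * h w)"
      using local_sheetD(5,7)[OF sheet(1) elim(6)] by (metis \<Phi>_def w_def)
    have "v (fst P, w ^ 3 - fst P * v (0, w ^ 3)) = v (0, w ^ 3)"
      using burgers_characteristic[OF W(3,1) pde line _ , of "e / 2" "w ^ 3" "fst P"] elim(4,5) by (simp add: w_def)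
    then show ?case unfolding init P[symmetric] by (simp add: w_def)
  qed
qed

lemma sheet_ramified_solution: "ramified_burgers_solution a0 b x0 U K (\<lambda>P. h (snd (g P)))"
  unfolding ramified_burgers_solution_def
proof (intro conjI allI impI)
  have w0: "b x0 \<noteq> 0" "(0, b x0 ^ 3) \<in> U" using x0 branch_at by auto
  show "characteristic_hypersurface (\<lambda>P. h (snd (g P))) (0, x0) U K"
    unfolding characteristic_hypersurface_def
  proof (intro exI[of _ S] conjI ballI)
    fix P assume "P \<in> K"
    then obtain \<sigma> where \<sigma>: "\<sigma> \<in> ball 0 \<rho>" "P = (\<sigma>\<^sup>2, Xe (\<sigma>\<^sup>2) + \<sigma> * Xo (\<sigma>\<^sup>2))" "P = \<Phi> (\<sigma>\<^sup>2, W \<sigma>)"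
      by (rule K_cases)
    show "\<exists>w. branch_limit (\<lambda>P. h (snd (g P))) (0, x0) U K P w \<and> deriv_t S P - w * deriv_x S P = 0"
    proof (intro exI[of _ "h (W \<sigma>)"] conjI)
      show "branch_limit (\<lambda>P. h (snd (g P))) (0, x0) U K P (h (W \<sigma>))"
        using branch_limit_critical[OF w0 sheet \<sigma>(1)] unfolding \<sigma>(3) branch_at .
      show "deriv_t S P - h (W \<sigma>) * deriv_x S P = 0"
        using S_characteristic[OF \<sigma>(1)] unfolding \<sigma>(2) .
    qed
  qed (rule S_holo K_eq S_reduced)+
  fix c assume "path c \<and> pathstart c = (0, x0) \<and> path_image c \<subseteq> U - K"
  then show "\<exists>F. continuation_along (\<lambda>P. h (snd (g P))) c {0..1} F"
    using initial_regular[OF w0] by (intro continuation_along_path[OF _ sheet]) (auto simp: \<Phi>_initial branch_at)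
qed (use x0 open_U zero_in_U K_initial sheet_cauchy_germ in auto)

end

lemma solution_exists_unique:
  assumes x0: "x0 \<noteq> 0" "(0, x0) \<in> U" and b: "cube_root_branch b x0"
  shows "\<exists>z. holomorphic2_near z (0, x0) \<and>
    (\<forall>\<^sub>F x in nhds x0. z (0, x) = b x) \<and>
    (\<forall>\<^sub>F P in nhds (0, x0). z P ^ 3 = lin_coeff P * z P + const_coeff P) \<and>
    ramified_burgers_solution a0 b x0 U K (\<lambda>P. avg P + z P) \<and>
    (\<forall>v. burgers_cauchy_germ a0 b x0 v \<longrightarrow> (\<forall>\<^sub>F P in nhds (0, x0). v P = avg P + z P))"
proof -
  have "b x0 ^ 3 = x0"
    using b eventually_nhds_x_imp_x unfolding cube_root_branch_def by blast
  then have "(0, b x0) \<in> regular_points"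
    using x0 by (intro initial_regular) auto
  then obtain N V g where sheet: "local_sheet N V g" "(0, b x0) \<in> N"
    using local_sheet_exists jac_nonzero regular_points_ball by blast
  define z where "z P = h (snd (g P)) - avg P" for P
  have u: "(\<lambda>P. avg P + z P) = (\<lambda>P. h (snd (g P)))" by (simp add: z_def)
  note ctx = x0 b sheet
  show ?thesis
  proof (intro exI[of _ z] conjI allI impI)
    have "holomorphic2_on z (V \<inter> U)"
      unfolding z_def[abs_def]
      using sheet_holomorphic[OF sheet(1)] avg_holo
      by (intro holomorphic2_on_diff) (auto elim: holomorphic2_on_subset)
    moreover have "open (V \<inter> U)" using local_sheetD(2)[OF sheet(1)] open_U by blast
    ultimately show "holomorphic2_near z (0, x0)"
      unfolding holomorphic2_near_def using base_in_V[OF ctx] x0 by blast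
    have "\<forall>\<^sub>F x in nhds x0. x \<in> ball 0 \<epsilon>"
      using x0 by (intro eventually_nhds_in_open) (auto simp: U_iff)
    moreover have "\<forall>\<^sub>F x in nhds x0. h (snd (g (0, x))) = a0 x + b x"
      using sheet_cauchy_germ[OF ctx] by (simp add: burgers_cauchy_germ_def)
    ultimately show "\<forall>\<^sub>F x in nhds x0. z (0, x) = b x"
    proof eventually_elim
      case (elim x)
      then have "(0, x) \<in> U" using \<rho>_pos by (simp add: U_iff)
      then show ?case using elim(2) initial_coeffs(1) by (simp add: z_def)
    qed
    show "\<forall>\<^sub>F P in nhds (0, x0). z P ^ 3 = lin_coeff P * z P + const_coeff P"
      using eventually_regular[OF ctx]
      by eventually_elim (unfold z_def, blast intro: cubic_relation)
    show "ramified_burgers_solution a0 b x0 U K (\<lambda>P. avg P + z P)"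
      unfolding u by (rule sheet_ramified_solution[OF ctx])
    show "\<forall>\<^sub>F P in nhds (0, x0). v P = avg P + z P" if "burgers_cauchy_germ a0 b x0 v" for v
      using sheet_unique[OF ctx that] by (simp add: z_def)
  qed
qed

end

theorem theorem4p1:
  fixes a0 :: "complex \<Rightarrow> complex" and D :: "complex set"
  assumes "open D" and "0 \<in> D" and "a0 holomorphic_on D"
  shows "\<exists>U K a p q.
    open U \<and> (0, 0) \<in> U \<and> (\<forall>x. (0, x) \<in> U \<longrightarrow> x \<in> D) \<and>
    holomorphic2_on a U \<and> holomorphic2_on p U \<and> holomorphic2_on q U \<and>
    (\<forall>x. (0, x) \<in> U \<longrightarrow> a (0, x) = a0 x \<and> p (0, x) = 0 \<and> q (0, x) = x) \<and>
    (\<forall>x0 b. x0 \<noteq> 0 \<and> (0, x0) \<in> U \<and> cube_root_branch b x0 \<longrightarrow>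
      (\<exists>z. holomorphic2_near z (0, x0) \<and>
        (\<forall>\<^sub>F x in nhds x0. z (0, x) = b x) \<and>
        (\<forall>\<^sub>F P in nhds (0, x0). z P ^ 3 = p P * z P + q P) \<and>
        ramified_burgers_solution a0 b x0 U K (\<lambda>P. a P + z P) \<and>
        (\<forall>v. burgers_cauchy_germ a0 b x0 v \<longrightarrow>
          (\<forall>\<^sub>F P in nhds (0, x0). v P = a P + z P))))"
proof -
  obtain d where d: "0 < d" "ball 0 d \<subseteq> D"
    using assms(1,2) open_contains_ball by blast
  \<comment> \<open>With \<open>R0 \<le> 1\<close>, \<open>cmod (w ^ 3) \<le> cmod w < d\<close>, so
    \<open>a0 (w ^ 3)\<close> is defined.\<close>
  define R0 where "R0 = min 1 d"
  define h where "h w = a0 (w ^ 3) + w" for w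
  have R0: "0 < R0" "R0 \<le> 1" "R0 \<le> d" using d(1) by (auto simp: R0_def)
  have cube: "w ^ 3 \<in> ball 0 d" if "w \<in> ball 0 R0" for w :: complex
  proof -
    have "cmod w ^ 3 \<le> cmod w ^ 1" using that R0 by (intro power_decreasing) auto
    then show ?thesis using that R0 by (simp add: norm_power)
  qed
  have a0d: "a0 holomorphic_on ball 0 d" using assms(3) d(2) by (rule holomorphic_on_subset)
  have h_holo: "h holomorphic_on ball 0 R0"
    unfolding h_def[abs_def] using cube
    by (intro holomorphic_intros holomorphic_on_compose_gen[unfolded o_def, OF _ a0d]) auto
  have "(a0 has_field_derivative deriv a0 0) (at (0 ^ 3))"
    using holomorphic_derivI[OF a0d open_ball, of 0] d(1) by simp
  then have "(h has_field_derivative deriv a0 0 * (3 * 0\<^sup>2) + 1) (at 0)"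
    unfolding h_def[abs_def]
    by (intro DERIV_add DERIV_chain2[of a0] DERIV_ident) (auto intro!: derivative_eq_intros)
  then have h'0: "deriv h 0 = 1" by (simp add: DERIV_imp_deriv)
  obtain R \<rho>1 W Xe Xo where R: "0 < R" "R \<le> R0" and \<rho>1: "0 < \<rho>1" and W: "W holomorphic_on ball 0 \<rho>1" "W 0 = 0"
    and cr: "\<And>\<sigma>. \<sigma> \<in> ball 0 \<rho>1 \<Longrightarrow> W \<sigma> \<in> ball 0 R"
    "\<And>\<sigma>. \<sigma> \<in> ball 0 \<rho>1 \<Longrightarrow> 3 * (W \<sigma>)\<^sup>2 = \<sigma>\<^sup>2 * deriv h (W \<sigma>)"
    "\<And>w t. w \<in> ball 0 R \<Longrightarrow> cmod t < \<rho>1\<^sup>2 \<Longrightarrow> 3 * w\<^sup>2 = t * deriv h w \<Longrightarrow> \<exists>\<sigma>\<in>ball 0 \<rho>1. \<sigma>\<^sup>2 = t \<and> W \<sigma> = w"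
    "Xe holomorphic_on ball 0 (\<rho>1\<^sup>2)" "Xo holomorphic_on ball 0 (\<rho>1\<^sup>2)"
    "\<And>\<sigma>. \<sigma> \<in> ball 0 \<rho>1 \<Longrightarrow> W \<sigma> ^ 3 - \<sigma>\<^sup>2 * h (W \<sigma>) = Xe (\<sigma>\<^sup>2) + \<sigma> * Xo (\<sigma>\<^sup>2)"
    "\<And>\<sigma>. \<sigma> \<in> ball 0 \<rho>1 \<Longrightarrow> \<sigma> \<noteq> 0 \<Longrightarrow> Xo (\<sigma>\<^sup>2) \<noteq> 0"
    "\<And>\<sigma>. \<sigma> \<in> ball 0 \<rho>1 \<Longrightarrow>
      2 * \<sigma> * deriv Xe (\<sigma>\<^sup>2) + Xo (\<sigma>\<^sup>2) + 2 * \<sigma>\<^sup>2 * deriv Xo (\<sigma>\<^sup>2) = - 2 * \<sigma> * h (W \<sigma>)"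
    using critical_curve[OF h_holo R0(1) h'0] by blast
  \<comment> \<open>Halving \<open>R\<close> leaves a compact disc inside the domain of
    \<open>h\<close>, on which the bound \<open>B\<close> exists.\<close>
  define R' where "R' = R / 2"
  define r where "r = R / 4"
  \<comment> \<open>With \<open>\<rho>^2 * B < \<epsilon> / 2\<close>, achieved below, this gives
    \<open>\<rho>^2 * B + \<epsilon> < r ^ 3\<close>. The choice of \<open>r2\<close> makes
    \<open>r2 ^ 3 < \<epsilon> / 2\<close>, the other half of the bound for the bidisc
    upstairs.\<close>
  define \<epsilon> where "\<epsilon> = r ^ 3 / 2"
  define r2 where "r2 = \<epsilon> / 4"
  have "continuous_on (cball 0 R') h"
    using R by (intro continuous_on_subset[OF holomorphic_on_imp_continuous_on[OF h_holo]]) (auto simp: R'_def)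
  then have "bounded (h ` cball 0 R')"
    using compact_cball compact_continuous_image compact_imp_bounded by blast
  then obtain B where B: "0 < B" "\<And>w. w \<in> cball 0 R' \<Longrightarrow> cmod (h w) \<le> B"
    unfolding bounded_pos by blast
  have rs: "0 < r" "r < R'" "r \<le> 1 / 4" "0 < \<epsilon>" "0 < r2" "r2 < r" "r2 ^ 3 < \<epsilon> / 2" "\<epsilon> < r" "\<epsilon> \<le> d"
  proof -
    show r: "0 < r" "r < R'" "r \<le> 1 / 4" using R R0 by (auto simp: r_def R'_def)
    then show "0 < \<epsilon>" "0 < r2" by (auto simp: \<epsilon>_def r2_def)
    have "r ^ 3 \<le> r ^ 1" using r by (intro power_decreasing) auto
    then show er: "\<epsilon> < r" using r by (simp add: \<epsilon>_def)
    then show "\<epsilon> \<le> d" using r R R0 by (simp add: r_def)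
    show r2: "r2 < r" using er \<open>0 < \<epsilon>\<close> by (simp add: r2_def)
    have "r2 ^ 3 \<le> r2 ^ 1" using r2 r \<open>0 < r2\<close> by (intro power_decreasing) auto
    then show "r2 ^ 3 < \<epsilon> / 2" using \<open>0 < \<epsilon>\<close> by (simp add: r2_def)
  qed
  have "isCont W 0"
    using holomorphic_on_imp_continuous_on[OF W(1)] \<rho>1 by (simp add: continuous_on_eq_continuous_at)
  then have "\<forall>\<^sub>F \<sigma> in nhds 0. dist (W \<sigma>) (W 0) < r2"
    unfolding isCont_def tendsto_at_iff_tendsto_nhds using rs(5) by (rule tendstoD)
  then obtain \<eta> where \<eta>: "0 < \<eta>" "\<And>\<sigma>. cmod \<sigma> < \<eta> \<Longrightarrow> cmod (W \<sigma>) < r2"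
    unfolding eventually_nhds_metric using W(2) by auto
  \<comment> \<open>As \<open>\<rho> \<le> 1\<close>, \<open>\<rho>^2 \<le> \<rho>\<close>, so the
    last bound gives \<open>\<rho>^2 * B < \<epsilon> / 2\<close>; \<open>\<eta>\<close> keeps
    \<open>W\<close> within radius \<open>r2\<close>.\<close>
  define \<rho> where "\<rho> = min (min \<rho>1 \<eta>) (min 1 (\<epsilon> / (2 * (B + 1))))"
  have \<rho>: "0 < \<rho>" "\<rho> \<le> \<rho>1" "\<rho> \<le> \<eta>" "\<rho> \<le> 1" "\<rho> \<le> \<epsilon> / (2 * (B + 1))"
    using \<rho>1 \<eta>(1) rs(4) B(1) by (auto simp: \<rho>_def)
  have "\<rho>\<^sup>2 * B < \<epsilon> / 2"
  proof -
    have "\<rho>\<^sup>2 \<le> \<rho> ^ 1" using \<rho> by (intro power_decreasing) auto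
    then have "\<rho>\<^sup>2 * B \<le> \<epsilon> / (2 * (B + 1)) * B" using \<rho>(5) B(1) by (intro mult_right_mono) auto
    also have "\<dots> < \<epsilon> / 2" using rs(4) B(1) by (simp add: field_simps)
    finally show ?thesis .
  qed
  have \<rho>2: "\<rho>\<^sup>2 \<le> \<rho>1\<^sup>2" using \<rho> by (intro power_mono) auto
  have sub: "\<sigma> \<in> ball 0 \<rho>1" if "\<sigma> \<in> ball 0 \<rho>" for \<sigma> :: complex using that \<rho>(2) by auto
  have h_deriv_sub: "h holomorphic_on ball 0 R'" using R by (intro holomorphic_on_subset[OF h_holo]) (auto simp: R'_def)
  interpret ramified_datum h R' r \<rho> \<epsilon> B W Xe Xo r2 a0
  proof
    show "\<exists>\<sigma>\<in>ball 0 \<rho>. \<sigma>\<^sup>2 = t \<and> W \<sigma> = w" if w: "w \<in> ball 0 R'" "cmod t < \<rho>\<^sup>2" "3 * w\<^sup>2 = t * deriv h w" for w t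
    proof -
      obtain \<sigma> where \<sigma>: "\<sigma>\<^sup>2 = t" "W \<sigma> = w"
        using cr(3)[of w t] w \<rho>2 R by (auto simp: R'_def)
      moreover have "cmod \<sigma> < \<rho>"
        using w(2) \<rho>(1) power_less_imp_less_base[of "cmod \<sigma>" 2 \<rho>] unfolding \<sigma>(1)[symmetric] by (simp add: norm_power)
      ultimately show ?thesis by auto
    qed
    show "continuous_on (ball 0 \<epsilon>) a0"
      using rs(9) by (intro continuous_on_subset[OF holomorphic_on_imp_continuous_on[OF a0d]]) auto
    show "cmod (h w) \<le> B" if "w \<in> ball 0 R'" for w using B(2)[of w] that by simp
    show "Xe holomorphic_on ball 0 (\<rho>\<^sup>2)" "Xo holomorphic_on ball 0 (\<rho>\<^sup>2)"
      using \<rho>2 by (auto intro: holomorphic_on_subset[OF cr(4)] holomorphic_on_subset[OF cr(5)])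
    show "\<rho>\<^sup>2 * B + \<epsilon> < r ^ 3" using \<open>\<rho>\<^sup>2 * B < \<epsilon> / 2\<close> rs(4) \<epsilon>_def by linarith
    show "r2 ^ 3 + \<rho>\<^sup>2 * B < \<epsilon>" using \<open>\<rho>\<^sup>2 * B < \<epsilon> / 2\<close> rs(7) by simp
    show "cmod (W \<sigma>) < r2" if "\<sigma> \<in> ball 0 \<rho>" for \<sigma> using \<eta>(2)[of \<sigma>] that \<rho>(3) by simp
  qed (use rs \<rho>(1) h_deriv_sub W(2) cr(2,6,7,8) sub in \<open>auto simp: h_def\<close>)
  have "\<forall>x. (0, x) \<in> U \<longrightarrow> x \<in> D"
    using d(2) rs(9) by (auto simp: U_iff)
  then show ?thesis
    using open_U zero_in_U avg_holo lin_coeff_holo const_coeff_holo initial_coeffs solution_exists_unique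
    by (intro exI[of _ U] exI[of _ K] exI[of _ avg] exI[of _ lin_coeff] exI[of _ const_coeff]) simp
qed

end
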